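(* Let $J=\mathbb{Z}^-$, let $X_1,X_2$ be Hilbert spaces, and let $A_{11}(n)\in\mathcal{L}(X_1)$, $A_{12}(n)\in\mathcal{L}(X_2,X_1)$, $A_{22}(n)\in\mathcal{L}(X_2)$ for $n\in\mathbb{Z}^-$, where $A_{ii}(n)$ is invertible for $i=1,2$ and $n\in\mathbb{Z}^-$. Suppose that the block triangular system $$x(n+1)=\begin{pmatrix}A_{11}(n)&A_{12}(n)\\0&A_{22}(n)\end{pmatrix}x(n),\quad n\in\mathbb{Z}^-\setminus\{0\},$$ on $X_1\times X_2$ admits an exponential dichotomy. For $i=1,2$ let $\Phi_{ii}(m,n)=A_{ii}(m-1)\cdots A_{ii}(n)$ for $n<m\le0$, $\Phi_{ii}(n,n)=\mathrm{Id}$, and $\Phi_{ii}(m,n)=(\Phi_{ii}(n,m))^{-1}$ for $m\le n\le0$. Then the block diagonal system $$x(n+1)=\begin{pmatrix}A_{11}(n)&0\\0&A_{22}(n)\end{pmatrix}x(n),\quad n\in\mathbb{Z}^-\setminus\{0\},$$ admits an exponential dichotomy if and only if the following two conditions hold: (1) the subspace $\mathcal{U}_2=\{v_2\in X_2:\ \sup_{n\in\mathbb{Z}^-}\|\Phi_{22}(n,0)v_2\|<+\infty\}$ is complemented in $X_2$; (2) the subspace $\{v_1\in X_1:\ \sup_{n\in\mathbb{Z}^-}\|\Phi_{11}(0,n)^*v_1\|<+\infty\}$ is complemented in $X_1$.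
   Context: $\mathbb{Z}^-$ is the set of nonpositive integers. $\mathcal{L}(X,Y)$ denotes the bounded linear operators $X\to Y$, and $\mathcal{L}(X)=\mathcal{L}(X,X)$; $T^*$ is the Hilbert space adjoint of $T$. $X_1\times X_2$ carries the norm $\|(x_1,x_2)\|=\max\{\|x_1\|,\|x_2\|\}$ (equivalent to its Hilbert norm). A (not necessarily closed) subspace $S$ of a Banach space $X$ is complemented if there is a closed subspace $Z\subset X$ with $X=S\oplus Z$ (algebraic direct sum). Exponential dichotomy. Let $X$ be a Banach space and $(A(n))_{n\in\mathbb{Z}^-}\subset\mathcal{L}(X)$. For $n\le m\le 0$ put $\Phi(m,n)=A(m-1)\cdots A(n)$ if $m>n$ and $\Phi(n,n)=\mathrm{Id}$. The system $x(n+1)=A(n)x(n)$, $n\in\mathbb{Z}^-\setminus\{0\}$, admits an exponential dichotomy if there exist (bounded) projections $(P(n))_{n\in\mathbb{Z}^-}\subset\mathcal{L}(X)$ and constants $K,\alpha>0$ such that: (i) for every $n\in\mathbb{Z}^-\setminus\{0\}$, $A(n)P(n)=P(n+1)A(n)$ and $A(n)|_{\mathcal{N}P(n)}:\mathcal{N}P(n)\to\mathcal{N}P(n+1)$ is invertible, where $\mathcal{N}P(n)$ is the kernel of $P(n)$; (ii) $\|\Phi(m,n)P(n)\|\le Ke^{-\alpha(m-n)}$ for $n\le m\le0$; (iii) $\|\Phi(m,n)(\mathrm{Id}-P(n))\|\le Ke^{-\alpha(n-m)}$ for $m\le n\le0$, where for $m\le n$, $\Phi(m,n):=(\Phi(n,m)|_{\mathcal{N}P(m)})^{-1}:\mathcal{N}P(n)\to\mathcal{N}P(m)$.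 *)

theory Defs
  imports "HOL-Analysis.Analysis"
begin

(* Scalars. Spaces over K = R and over K = C are treated at once: by Gelfand-Mazur, the types of
   class real_normed_field are exactly R and C.  A K-Hilbert space is a real Hilbert space (the type
   class, with the real part of the scalar product as its inner product) together with a scalar
   multiplication by K that extends the real one and for which the norm is homogeneous.  For K = R
   it has to be scaleR.  For K = C the sesquilinear scalar product is recovered by polarization. *)

definition normed_scaling :: "('k::real_normed_field \<Rightarrow> 'a::real_normed_vector \<Rightarrow> 'a) \<Rightarrow> bool" where
  "normed_scaling s \<longleftrightarrow>
     vector_space s \<and> (\<forall>r x. s (of_real r) x = r *\<^sub>R x) \<and> (\<forall>c x. norm (s c x) = norm c * norm x)"

lemma normed_scaling_scaleR: "normed_scaling (scaleR :: real \<Rightarrow> 'a::real_normed_vector \<Rightarrow> 'a)"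
  unfolding normed_scaling_def by (auto simp: real_vector.vector_space_axioms)

lemma normed_scaling_complex: "normed_scaling ((*) :: complex \<Rightarrow> complex \<Rightarrow> complex)"
  unfolding normed_scaling_def
  by (auto simp: norm_mult scaleR_conv_of_real vector_space_def algebra_simps)

definition complemented :: "('k::field \<Rightarrow> 'a::real_normed_vector \<Rightarrow> 'a) \<Rightarrow> 'a set \<Rightarrow> bool" where
  "complemented s S \<longleftrightarrow>
     (\<exists>Z. module.subspace s Z \<and> closed Z \<and> S \<inter> Z = {0} \<and> {u + z |u z. u \<in> S \<and> z \<in> Z} = UNIV)"

definition invertible_blinfun :: "('a::real_normed_vector \<Rightarrow>\<^sub>L 'b::real_normed_vector) \<Rightarrow> bool" where
  "invertible_blinfun T \<longleftrightarrow> (\<exists>S. S o\<^sub>L T = id_blinfun \<and> T o\<^sub>L S = id_blinfun)"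

(* Sequences indexed by the nonpositive integers are functions on int, used only at n <= 0. *)

primrec iterate ::
  "(int \<Rightarrow> 'a::real_normed_vector \<Rightarrow>\<^sub>L 'a) \<Rightarrow> int \<Rightarrow> nat \<Rightarrow> 'a \<Rightarrow>\<^sub>L 'a" where
  "iterate A n 0 = id_blinfun"
| "iterate A n (Suc k) = A (n + int k) o\<^sub>L iterate A n k"

(* A (m - 1) ... A n, for n <= m *)
definition transition ::
  "(int \<Rightarrow> 'a::real_normed_vector \<Rightarrow>\<^sub>L 'a) \<Rightarrow> int \<Rightarrow> int \<Rightarrow> 'a \<Rightarrow>\<^sub>L 'a" where
  "transition A m n = iterate A n (nat (m - n))"

(* The two-sided transition operator, for invertible coefficients *)
definition full_transition ::
  "(int \<Rightarrow> 'a::real_normed_vector \<Rightarrow>\<^sub>L 'a) \<Rightarrow> int \<Rightarrow> int \<Rightarrow> 'a \<Rightarrow> 'a" where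
  "full_transition A m n =
     (if n \<le> m then blinfun_apply (transition A m n) else inv (blinfun_apply (transition A n m)))"

definition ker :: "('a::real_normed_vector \<Rightarrow>\<^sub>L 'b::real_normed_vector) \<Rightarrow> 'a set" where
  "ker T = {x. blinfun_apply T x = 0}"

(* The last bound is that of the operator norm, written pointwise: inv_into yields a plain
   function rather than a blinfun. *)
definition exp_dichotomy ::
  "('k::real_normed_field \<Rightarrow> 'a::banach \<Rightarrow> 'a) \<Rightarrow> (int \<Rightarrow> 'a \<Rightarrow>\<^sub>L 'a) \<Rightarrow> bool" where
  "exp_dichotomy s A \<longleftrightarrow>
    (\<exists>(P :: int \<Rightarrow> 'a \<Rightarrow>\<^sub>L 'a) (K :: real) (\<alpha> :: real). 0 < K \<and> 0 < \<alpha> \<and>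
      (\<forall>n\<le>0. Vector_Spaces.linear s s (blinfun_apply (P n)) \<and> P n o\<^sub>L P n = P n) \<and>
      (\<forall>n<0. A n o\<^sub>L P n = P (n + 1) o\<^sub>L A n \<and>
             bij_betw (blinfun_apply (A n)) (ker (P n)) (ker (P (n + 1)))) \<and>
      (\<forall>n m. n \<le> m \<and> m \<le> 0 \<longrightarrow>
             norm (transition A m n o\<^sub>L P n) \<le> K * exp (- \<alpha> * real_of_int (m - n))) \<and>
      (\<forall>m n. m \<le> n \<and> n \<le> 0 \<longrightarrow>
             (\<forall>x. norm (inv_into (ker (P m)) (blinfun_apply (transition A n m)) (x - P n x))
                    \<le> K * exp (- \<alpha> * real_of_int (n - m)) * norm x)))"

(* The product type carries the Hilbert norm.  It is equivalent to the maximum norm, and passing to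
   an equivalent norm only changes the constant K of a dichotomy. *)
definition block_upper ::
  "('a::real_normed_vector \<Rightarrow>\<^sub>L 'a) \<Rightarrow> ('b::real_normed_vector \<Rightarrow>\<^sub>L 'a) \<Rightarrow> ('b \<Rightarrow>\<^sub>L 'b)
    \<Rightarrow> ('a \<times> 'b) \<Rightarrow>\<^sub>L ('a \<times> 'b)" where
  "block_upper A B D = Blinfun (\<lambda>(x, y). (A x + B y, D y))"

lemma block_upper_apply [simp]: "blinfun_apply (block_upper A B D) (x, y) = (A x + B y, D y)"
proof -
  have "bounded_linear (\<lambda>p. (A (fst p) + B (snd p), D (snd p)))"
    by (intro bounded_linear_intros)
  then show ?thesis
    by (simp add: block_upper_def case_prod_unfold bounded_linear_Blinfun_apply)
qed

end

theory Submission
  imports Defs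
begin

text \<open>
  Let \<open>G(m,n)\<close> be the Green function of the triangular system: \<open>\<Phi>(m,n) P(n)\<close> for \<open>m \<ge> n\<close> and
  \<open>- \<Phi>(m,n) (Id - P(n))\<close> for \<open>m < n\<close>. Its lower right corner decays exponentially and is a Green
  function of \<open>A22\<close>, except that the corner \<open>p(n)\<close> of \<open>P(n)\<close> is neither a projection nor invariant.
  If the space \<open>U\<close> of initial values of bounded orbits of \<open>A22\<close> is complemented, a Baire argument bounds
  both the projection \<open>R\<close> onto \<open>U\<close> and the orbits, uniformly. As \<open>Id - p(n)\<close> maps into the bounded
  orbits, \<open>a(k) = \<parallel>\<Phi>(k,0) R\<parallel>\<close> satisfies
  \<open>a(k) \<le> (K exp(- \<alpha> (n - k)) + a(k) K exp(\<alpha> n)) a(n)\<close> for \<open>k \<le> n \<le> 0\<close>; a fixed, very negative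
  \<open>n\<close> absorbs the second term, so \<open>a(k)\<close> decays at the rate \<open>\<alpha>\<close>, and transporting \<open>Id - R\<close>
  along the evolution gives a dichotomy of \<open>A22\<close>. The block \<open>A11\<close> is treated in the same way after
  passing to the transposed evolution \<open>(m,n) \<mapsto> \<Phi>(n,m)\<^sup>*\<close>, for which condition (2) is condition (1).

  Conversely, a dichotomy of the diagonal system makes the space in (1) the preimage of the kernel of
  \<open>P(0)\<close>, hence closed, and the space in (2) the orthogonal complement of the corresponding space for
  \<open>A11\<close>; closed subspaces of a Hilbert space are complemented.
\<close>

section \<open>Banach and Hilbert space preliminaries\<close>

text \<open>Zabreiko's lemma. Baire gives a sublevel set of \<open>p\<close> whose closure contains
  a ball; convexity and symmetry move the ball to the origin. Successive approximation then writes
  each \<open>x\<close> as a series of vectors on which \<open>p\<close> is controlled, and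
  countable subadditivity bounds \<open>p x\<close>.\<close>

lemma Zabreiko_seminorm_bound:
  fixes p :: "'a::banach \<Rightarrow> real"
  assumes scale: "\<And>r x. p (r *\<^sub>R x) = \<bar>r\<bar> * p x"
    and csub: "\<And>f. summable f \<Longrightarrow> summable (\<lambda>n. p (f n)) \<Longrightarrow> p (\<Sum>n. f n) \<le> (\<Sum>n. p (f n))"
  obtains C where "0 \<le> C" "\<And>x. p x \<le> C * norm x"
proof -
  have p0: "p 0 = 0"
    using scale[of 0 0] by simp
  \<comment> \<open>Countable subadditivity yields the finite case by padding with zeros, where
    \<open>p\<close> vanishes.\<close>
  have tri: "p (x + y) \<le> p x + p y" for x y
  proof -
    let ?f = "\<lambda>n::nat. if n = 0 then x else if n = 1 then y else 0"
    have f: "?f sums (x + y)"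
      using sums_finite[of "{0,1}" ?f] by simp
    have "(\<lambda>n. p (?f n)) = (\<lambda>n. if n = 0 then p x else if n = 1 then p y else 0)"
      by (auto simp: p0)
    then have "(\<lambda>n. p (?f n)) sums (p x + p y)"
      using sums_finite[of "{0,1}" "\<lambda>n. p (?f n)"] by (simp add: p0)
    with f csub[of ?f] show ?thesis
      by (simp add: sums_iff)
  qed
  have pminus: "p (- x) = p x" for x
    using scale[of "-1" x] by simp
  have pnn: "0 \<le> p x" for x
    using tri[of x "- x"] by (simp add: p0 pminus)
  define A where "A N = {x. p x \<le> real N}" for N
  have "\<exists>N. interior (closure (A N)) \<noteq> {}"
  proof (rule ccontr)
    assume "\<nexists>N. interior (closure (A N)) \<noteq> {}"
    then have "euclidean interior_of \<Union>(range (\<lambda>N. closure (A N))) = {}"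
      by (intro Baire_category_alt) (auto simp: completely_metrizable_space_euclidean)
    moreover have "\<Union>(range (\<lambda>N. closure (A N))) = UNIV"
    proof -
      have "x \<in> closure (A (nat \<lceil>p x\<rceil>))" for x
        by (intro closure_subset[THEN subsetD]) (simp add: A_def pnn)
      then show ?thesis by blast
    qed
    ultimately show False by simp
  qed
  then obtain N x0 r where r: "0 < r" and sub: "ball x0 r \<subseteq> closure (A N)"
    by (metis all_not_in_conv mem_interior)
  have conv: "convex (closure (A N))"
  proof (intro convex_closure convexI)
    fix x y and u v :: real
    assume *: "x \<in> A N" "y \<in> A N" "0 \<le> u" "0 \<le> v" "u + v = 1"
    have "p (u *\<^sub>R x + v *\<^sub>R y) \<le> u * p x + v * p y"
      using tri[of "u *\<^sub>R x" "v *\<^sub>R y"] * by (simp add: scale)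
    also have "\<dots> \<le> real N"
      using * by (intro convex_bound_le) (auto simp: A_def)
    finally show "u *\<^sub>R x + v *\<^sub>R y \<in> A N" by (simp add: A_def)
  qed
  have symm: "- x \<in> closure (A N)" if "x \<in> closure (A N)" for x
  proof (unfold closure_approachable, intro allI impI)
    fix e :: real assume "0 < e"
    with that obtain y where "y \<in> A N" "dist y x < e"
      by (auto simp: closure_approachable)
    then show "\<exists>y\<in>A N. dist y (- x) < e"
      by (intro bexI[of _ "- y"]) (auto simp: A_def pminus dist_minus)
  qed
  \<comment> \<open>\<open>h\<close> is the midpoint of \<open>x0 + h\<close> and the reflection of
    \<open>x0 - h\<close>.\<close>
  have ball: "h \<in> closure (A N)" if "norm h < r" for h
  proof -
    have "x0 + h \<in> closure (A N)" "x0 - h \<in> closure (A N)"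
      using that sub by (auto simp: subset_iff dist_norm)
    then have "(1/2) *\<^sub>R (x0 + h) + (1/2) *\<^sub>R (- (x0 - h)) \<in> closure (A N)"
      using conv symm[of "x0 - h"] by (intro convexD) auto
    moreover have "(1/2) *\<^sub>R (x0 + h) + (1/2) *\<^sub>R (- (x0 - h)) = h"
      by (simp add: algebra_simps flip: scaleR_left.add)
    ultimately show ?thesis by simp
  qed
  define M where "M = 2 * real N / r"
  \<comment> \<open>Rescale \<open>x\<close> to norm \<open>r / 2\<close>, approximate it in
    \<open>A N\<close> up to \<open>r / 4\<close>, and scale back by \<open>t\<close>: the error
    becomes at most half of \<open>norm x\<close>, and \<open>t * real N\<close> is where
    \<open>M\<close> comes from.\<close>
  have "\<exists>y. p y \<le> M * norm x \<and> norm (x - y) \<le> norm x / 2" for x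
  proof (cases "x = 0")
    case True
    then show ?thesis by (intro exI[of _ 0]) (simp add: p0)
  next
    case False
    define t where "t = 2 * norm x / r"
    have t: "0 < t" using False r by (simp add: t_def)
    have "norm ((1 / t) *\<^sub>R x) < r" using r False by (simp add: t_def)
    then obtain y where y: "y \<in> A N" "dist y ((1 / t) *\<^sub>R x) < r / 4"
      using ball r by (meson closure_approachable zero_less_divide_iff zero_less_numeral)
    have "norm (x - t *\<^sub>R y) = norm (t *\<^sub>R (y - (1 / t) *\<^sub>R x))"
      using t by (simp add: algebra_simps norm_minus_commute)
    also have "\<dots> = t * norm (y - (1 / t) *\<^sub>R x)"
      using t by (simp only: norm_scaleR abs_of_pos)
    also have "\<dots> \<le> t * (r / 4)"
      using y t by (intro mult_left_mono) (auto simp: dist_norm)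
    finally have "norm (x - t *\<^sub>R y) \<le> norm x / 2"
      using r by (simp add: t_def)
    moreover have "p (t *\<^sub>R y) \<le> t * real N"
      using y t by (simp add: scale A_def)
    then have "p (t *\<^sub>R y) \<le> M * norm x"
      by (simp add: t_def M_def mult_ac)
    ultimately show ?thesis by blast
  qed
  then obtain g where g: "\<And>x. p (g x) \<le> M * norm x" "\<And>x. norm (x - g x) \<le> norm x / 2"
    by metis
  have "p x \<le> 2 * M * norm x" for x
  proof -
    \<comment> \<open>\<open>R k\<close> is the residue after \<open>k\<close> approximations; its
      norm is at least halved each time, and the corrections \<open>g (R k)\<close> telescope to
      \<open>x\<close>.\<close>
    define R where "R k = ((\<lambda>x. x - g x) ^^ k) x" for k
    have R: "norm (R k) \<le> norm x * (1/2) ^ k" for k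
    proof (induction k)
      case (Suc k)
      then show ?case using g(2)[of "R k"] by (simp add: R_def)
    qed (simp add: R_def)
    have "R \<longlonglongrightarrow> 0"
    proof (rule Lim_null_comparison)
      show "\<forall>\<^sub>F k in sequentially. norm (R k) \<le> norm x * (1/2) ^ k"
        using R by simp
      show "(\<lambda>k. norm x * (1/2) ^ k) \<longlonglongrightarrow> 0"
        using tendsto_mult_right_zero[OF LIMSEQ_power_zero[of "1/2::real"]] by simp
    qed
    then have "(\<lambda>k. R k - R (Suc k)) sums (R 0 - 0)"
      by (rule telescope_sums')
    then have "(\<lambda>k. g (R k)) sums x"
      by (simp add: R_def)
    moreover have le: "p (g (R k)) \<le> M * norm x * (1/2) ^ k" for k
    proof -
      have "p (g (R k)) \<le> M * norm (R k)" by (rule g)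
      also have "\<dots> \<le> M * (norm x * (1/2) ^ k)"
        using R r by (intro mult_left_mono) (auto simp: M_def)
      finally show ?thesis by (simp add: mult_ac)
    qed
    have sums: "(\<lambda>k. M * norm x * (1/2) ^ k) sums (M * norm x * 2)"
      using sums_mult[OF geometric_sums[of "1/2::real"], of "M * norm x"] by simp
    then have s: "summable (\<lambda>k. p (g (R k)))"
      by (intro summable_comparison_test'[OF sums_summable[OF sums]]) (use le pnn in auto)
    moreover have "(\<Sum>k. p (g (R k))) \<le> M * norm x * 2"
      using suminf_le[OF le s sums_summable[OF sums]] sums by (simp add: sums_iff)
    ultimately show ?thesis
      using csub[of "\<lambda>k. g (R k)"] by (simp add: sums_iff)
  qed
  moreover have "0 \<le> 2 * M" using r by (simp add: M_def)
  ultimately show thesis using that by blast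
qed

section \<open>Orthogonal projection, Riesz representation and adjoints\<close>

text \<open>A minimising sequence for the distance to \<open>S\<close> is Cauchy by the
  parallelogram law, since midpoints stay in \<open>S\<close>; minimality of the limit forces
  orthogonality in every direction \<open>w\<close>.\<close>

lemma orthogonal_decomposition:
  fixes S :: "'a::{real_inner,banach} set"
  assumes S: "closed S" "subspace S"
  obtains u where "u \<in> S" "\<And>w. w \<in> S \<Longrightarrow> (x - u) \<bullet> w = 0"
proof -
  define d where "d = infdist x S"
  have ne: "S \<noteq> {}" using subspace_0[OF S(2)] by auto
  have "\<exists>u\<in>S. (norm (x - u))\<^sup>2 < d\<^sup>2 + inverse (Suc n)" for n
  proof -
    have "d < sqrt (d\<^sup>2 + inverse (Suc n))"
      by (rule real_less_rsqrt) simp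
    then obtain u where "u \<in> S" "dist x u < sqrt (d\<^sup>2 + inverse (Suc n))"
      unfolding d_def infdist_notempty[OF ne] using ne by (subst (asm) cInf_less_iff) (auto intro!: bdd_belowI2[of _ 0])
    moreover then have "sqrt ((dist x u)\<^sup>2) < sqrt (d\<^sup>2 + inverse (Suc n))"
      by simp
    then have "(dist x u)\<^sup>2 < d\<^sup>2 + inverse (Suc n)"
      by (simp only: real_sqrt_less_iff)
    ultimately show ?thesis by (auto simp: dist_norm)
  qed
  then obtain u where u: "\<And>n. u n \<in> S" "\<And>n. (norm (x - u n))\<^sup>2 < d\<^sup>2 + inverse (Suc n)"
    by metis
  have d: "d\<^sup>2 \<le> (norm (x - w))\<^sup>2" if "w \<in> S" for w
    using infdist_le[OF that, of x] infdist_nonneg[of x S] by (simp add: d_def dist_norm power_mono)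
  have par: "(norm (u m - u n))\<^sup>2 \<le> 2 * inverse (Suc m) + 2 * inverse (Suc n)" for m n
  proof -
    have "(1/2) *\<^sub>R (u m + u n) \<in> S"
      using S u by (simp add: subspace_add subspace_scale)
    from d[OF this] have "4 * d\<^sup>2 \<le> 4 * (norm (x - (1/2) *\<^sub>R (u m + u n)))\<^sup>2" by simp
    also have "\<dots> = (norm (2 *\<^sub>R (x - (1/2) *\<^sub>R (u m + u n))))\<^sup>2" by (simp add: power_mult_distrib)
    also have "2 *\<^sub>R (x - (1/2) *\<^sub>R (u m + u n)) = (x - u m) + (x - u n)"
      by (simp add: algebra_simps scaleR_2)
    finally have "4 * d\<^sup>2 \<le> (norm ((x - u m) + (x - u n)))\<^sup>2" .
    moreover have "(norm ((x - u m) + (x - u n)))\<^sup>2 + (norm (u m - u n))\<^sup>2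
        = 2 * (norm (x - u m))\<^sup>2 + 2 * (norm (x - u n))\<^sup>2"
      by (simp add: power2_norm_eq_inner algebra_simps inner_commute)
    ultimately show ?thesis using u(2)[of m] u(2)[of n] by simp
  qed
  have "Cauchy u"
  proof (rule metric_CauchyI)
    fix e :: real assume "0 < e"
    then obtain N where N: "inverse (real (Suc N)) < e\<^sup>2 / 4"
      using reals_Archimedean[of "e\<^sup>2 / 4"] by auto
    have "dist (u m) (u n) < e" if "N \<le> m" "N \<le> n" for m n
    proof (rule power2_less_imp_less)
      have "inverse (real (Suc m)) \<le> inverse (real (Suc N))" "inverse (real (Suc n)) \<le> inverse (real (Suc N))"
        using that by (auto intro!: le_imp_inverse_le)
      then show "(dist (u m) (u n))\<^sup>2 < e\<^sup>2"
        using par[of m n] N unfolding dist_norm by linarith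
    qed (use \<open>0 < e\<close> in simp)
    then show "\<exists>N. \<forall>m\<ge>N. \<forall>n\<ge>N. dist (u m) (u n) < e" by blast
  qed
  then obtain l where l: "u \<longlonglongrightarrow> l"
    using Cauchy_convergent convergent_def by blast
  have lS: "l \<in> S"
    using closed_sequentially[OF S(1)] u(1) l by blast
  have "(norm (x - l))\<^sup>2 \<le> d\<^sup>2 + 0"
  proof (rule LIMSEQ_le)
    show "(\<lambda>n. (norm (x - u n))\<^sup>2) \<longlonglongrightarrow> (norm (x - l))\<^sup>2"
      by (intro tendsto_intros l)
    show "(\<lambda>n. d\<^sup>2 + inverse (Suc n)) \<longlonglongrightarrow> d\<^sup>2 + 0"
      by (intro tendsto_intros LIMSEQ_inverse_real_of_nat)
  qed (use u(2) in \<open>auto intro: less_imp_le\<close>)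
  have min: "(norm (x - l))\<^sup>2 \<le> (norm (x - w))\<^sup>2" if "w \<in> S" for w
    using d[OF that] \<open>(norm (x - l))\<^sup>2 \<le> d\<^sup>2 + 0\<close> by linarith
  have "(x - l) \<bullet> w = 0" if "w \<in> S" for w
  proof (cases "w = 0")
    case False
    \<comment> \<open>The best step along \<open>w\<close>: it would lower the squared distance by
      \<open>((x - l) \<bullet> w)\<^sup>2 / (w \<bullet> w)\<close>, so minimality makes this
      quotient zero.\<close>
    define t where "t = ((x - l) \<bullet> w) / (w \<bullet> w)"
    have "l + t *\<^sub>R w \<in> S"
      using S lS that by (simp add: subspace_add subspace_scale)
    from min[OF this] have "2 * t * ((x - l) \<bullet> w) \<le> t * t * (w \<bullet> w)"
      by (simp add: power2_norm_eq_inner algebra_simps inner_commute)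
    moreover have "t * t * (w \<bullet> w) = t * ((x - l) \<bullet> w)"
      using False by (simp add: t_def)
    ultimately have "t * ((x - l) \<bullet> w) \<le> 0" by simp
    moreover have "t * ((x - l) \<bullet> w) = ((x - l) \<bullet> w)\<^sup>2 / (w \<bullet> w)"
      by (simp add: t_def power2_eq_square)
    moreover have "0 < w \<bullet> w" using False by simp
    ultimately show ?thesis
      by (simp add: divide_le_0_iff)
  qed simp
  with lS that show thesis by blast
qed

text \<open>The representing vector is a multiple of the component \<open>z\<close>, orthogonal to
  the kernel, of a point outside the kernel: \<open>v - (f v / f z) *\<^sub>R z\<close> lies in the
  kernel, hence is orthogonal to \<open>z\<close>.\<close>

lemma Riesz_representation:
  fixes f :: "'a::{real_inner,banach} \<Rightarrow> real"
  assumes "bounded_linear f"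
  obtains y where "\<And>x. f x = x \<bullet> y"
proof (cases "\<forall>x. f x = 0")
  case True
  then show thesis using that[of 0] by simp
next
  case False
  interpret f: bounded_linear f by fact
  from False obtain x where x: "f x \<noteq> 0" by blast
  have "closed {v. f v = 0}"
    by (intro closed_Collect_eq f.continuous_on continuous_intros)
  moreover have "subspace {v. f v = 0}"
    by (auto simp: subspace_def f.zero f.add f.scaleR)
  ultimately obtain u where u: "f u = 0" "\<And>w. f w = 0 \<Longrightarrow> (x - u) \<bullet> w = 0"
    by (rule orthogonal_decomposition[of _ x]) auto
  define z where "z = x - u"
  have fz: "f z = f x" by (simp add: z_def f.diff u)
  then have z: "z \<noteq> 0" using x f.zero by auto
  have "f v = v \<bullet> ((f z / (z \<bullet> z)) *\<^sub>R z)" for v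
  proof -
    have "f (v - (f v / f z) *\<^sub>R z) = 0"
      using x fz by (simp add: f.diff f.scaleR)
    from u(2)[OF this] have "z \<bullet> v = (f v / f z) * (z \<bullet> z)"
      by (simp add: z_def[symmetric] inner_diff_right)
    then show ?thesis using x fz z by (simp add: inner_commute)
  qed
  with that show thesis by blast
qed

text \<open>The Hilbert space adjoint as a bounded operator, so that it can be composed and has an
  operator norm.\<close>

definition adj :: "('a::{real_inner,banach} \<Rightarrow>\<^sub>L 'b::real_inner) \<Rightarrow> 'b \<Rightarrow>\<^sub>L 'a" where
  "adj T = Blinfun (adjoint (blinfun_apply T))"

text \<open>The Riesz vectors of the functionals \<open>\<lambda>x. T x \<bullet> y\<close> form the
  adjoint; testing with \<open>x = f y\<close> bounds its norm.\<close>

lemma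
  fixes T :: "'a::{real_inner,banach} \<Rightarrow>\<^sub>L 'b::real_inner"
  shows adj_inner: "T x \<bullet> y = x \<bullet> adj T y"
  and adjoint_eq_adj: "adjoint (blinfun_apply T) = blinfun_apply (adj T)"
  and norm_adj_le: "norm (adj T) \<le> norm T"
proof -
  have "\<exists>z. \<forall>x. T x \<bullet> y = x \<bullet> z" for y
    by (rule Riesz_representation[of "\<lambda>x. T x \<bullet> y"]) (auto intro!: bounded_linear_intros)
  then obtain f where f: "\<And>x y. T x \<bullet> y = x \<bullet> f y" by metis
  have adjoint: "adjoint (blinfun_apply T) = f"
    using f by (intro adjoint_unique) simp
  have le: "norm (f y) \<le> norm T * norm y" for y
  proof (cases "f y = 0")
    case False
    have "norm (f y) * norm (f y) = T (f y) \<bullet> y"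
      by (simp add: f norm_eq_sqrt_inner)
    also have "\<dots> \<le> norm (T (f y)) * norm y"
      by (rule norm_cauchy_schwarz)
    also have "\<dots> \<le> norm T * norm (f y) * norm y"
      by (intro mult_right_mono norm_blinfun) simp
    finally show ?thesis using False by (simp add: mult_ac)
  qed simp
  have "bounded_linear f"
  proof (rule bounded_linear_intro)
    show "f (x + y) = f x + f y" for x y
      by (rule vector_eq_rdot[THEN iffD1]) (metis (no_types) f inner_add_right inner_commute)
    show "f (r *\<^sub>R x) = r *\<^sub>R f x" for r x
      by (rule vector_eq_rdot[THEN iffD1]) (metis (no_types) f inner_scaleR_right inner_commute)
    show "norm (f x) \<le> norm x * norm T" for x
      using le[of x] by (simp add: mult.commute)
  qed
  then have *: "blinfun_apply (adj T) = f"
    by (simp add: adj_def adjoint bounded_linear_Blinfun_apply)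
  show "T x \<bullet> y = x \<bullet> adj T y" by (simp add: * f)
  show "adjoint (blinfun_apply T) = blinfun_apply (adj T)" by (simp add: * adjoint)
  show "norm (adj T) \<le> norm T"
    by (rule norm_blinfun_bound) (auto simp: * le)
qed

lemma adj_unique:
  fixes T :: "'a::{real_inner,banach} \<Rightarrow>\<^sub>L 'b::real_inner" and S :: "'b \<Rightarrow>\<^sub>L 'a"
  assumes "\<And>x y. T x \<bullet> y = x \<bullet> S y"
  shows "adj T = S"
  by (rule blinfun_eqI, rule vector_eq_rdot[THEN iffD1]) (metis adj_inner assms inner_commute)

lemma adj_compose:
  fixes T :: "'a::{real_inner,banach} \<Rightarrow>\<^sub>L 'b::{real_inner,banach}" and S :: "'b \<Rightarrow>\<^sub>L 'c::real_inner"
  shows "adj (S o\<^sub>L T) = adj T o\<^sub>L adj S"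
  by (rule adj_unique) (simp add: adj_inner)

lemma adj_id [simp]: "adj id_blinfun = id_blinfun"
  by (rule adj_unique) simp

lemma adj_diff: "adj (S - T) = adj S - adj T"
  by (rule adj_unique) (simp add: blinfun.diff_left inner_diff adj_inner)

lemma adj_adj [simp]:
  fixes T :: "'a::{real_inner,banach} \<Rightarrow>\<^sub>L 'b::{real_inner,banach}"
  shows "adj (adj T) = T"
  by (rule adj_unique) (metis adj_inner inner_commute)

section \<open>Compatibility of operators and subspaces with the scalar field\<close>

lemma linear_blinfun_iff:
  assumes "normed_scaling s" "normed_scaling s'"
  shows "Vector_Spaces.linear s s' (blinfun_apply T) \<longleftrightarrow> (\<forall>c x. T (s c x) = s' c (T x))"
  using assms by (auto simp: Vector_Spaces.linear_iff normed_scaling_def blinfun.add_right)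

lemma subspace_normed_scaling_iff:
  assumes "normed_scaling s"
  shows "module.subspace s S \<longleftrightarrow> 0 \<in> S \<and> (\<forall>x\<in>S. \<forall>y\<in>S. x + y \<in> S) \<and> (\<forall>c. \<forall>x\<in>S. s c x \<in> S)"
proof -
  have "module s"
    using assms by (simp add: normed_scaling_def module_iff_vector_space)
  then show ?thesis by (simp add: module.subspace_def)
qed

lemma subspace_scaling:
  assumes "normed_scaling s" "module.subspace s S" "x \<in> S"
  shows "s c x \<in> S"
  using assms(2,3) unfolding subspace_normed_scaling_iff[OF assms(1)] by metis

lemma normed_scaling_simps:
  assumes "normed_scaling s"
  shows "s c (x + y) = s c x + s c y" "s c (x - y) = s c x - s c y" "s 0 x = 0" "s c 0 = 0"
    "c \<noteq> 0 \<Longrightarrow> s c (s (inverse c) x) = x" "s (of_real r) x = r *\<^sub>R x"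
    "norm (s c x) = norm c * norm x"
proof -
  interpret vector_space s using assms by (simp add: normed_scaling_def)
  show "s c (x + y) = s c x + s c y" "s c (x - y) = s c x - s c y" "s 0 x = 0" "s c 0 = 0"
    "c \<noteq> 0 \<Longrightarrow> s c (s (inverse c) x) = x" "s (of_real r) x = r *\<^sub>R x"
    "norm (s c x) = norm c * norm x"
    using assms by (auto simp: normed_scaling_def scale_right_distrib scale_right_diff_distrib)
qed

lemma subspace_scaleR_normed_scaling:
  assumes "normed_scaling s" "module.subspace s S"
  shows "subspace S"
  using assms(2) unfolding subspace_normed_scaling_iff[OF assms(1)] real_vector.subspace_def
  by (metis normed_scaling_simps(6)[OF assms(1)])

lemma normed_scaling_prod:
  assumes "normed_scaling s1" "normed_scaling s2"
  shows "normed_scaling (module_prod.scale s1 s2)"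
    and "module_prod.scale s1 s2 c (x, y) = (s1 c x, s2 c y)"
proof -
  interpret vector_space_prod s1 s2
    using assms by (simp add: normed_scaling_def vector_space_prod_def vector_space_pair_def)
  show *: "scale c (x, y) = (s1 c x, s2 c y)" for c x y by (rule scale_prod)
  show "normed_scaling scale"
    unfolding normed_scaling_def
  proof (intro conjI allI)
    show "vector_space scale" by (rule p.vector_space_axioms)
    show "scale (of_real r) x = r *\<^sub>R x" for r x
      by (cases x) (simp add: * normed_scaling_simps[OF assms(1)] normed_scaling_simps[OF assms(2)])
    show "norm (scale c x) = norm c * norm x" for c x
      by (cases x) (simp add: * normed_scaling_simps[OF assms(1)] normed_scaling_simps[OF assms(2)]
          norm_Pair power_mult_distrib real_sqrt_mult flip: distrib_left)
  qed
qed

text \<open>By polarization, homogeneity of the norm gives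
  \<open>s c x \<bullet> s c z = (norm c)\<^sup>2 * (x \<bullet> z)\<close>. Thus the real adjoint
  of multiplication by \<open>c\<close> is again a scalar multiplication, by the conjugate of
  \<open>c\<close>.\<close>

lemma normed_scaling_inner:
  fixes s :: "'k::real_normed_field \<Rightarrow> 'a::real_inner \<Rightarrow> 'a"
  assumes s: "normed_scaling s" and "c \<noteq> 0"
  shows "s c x \<bullet> y = (norm c)\<^sup>2 * (x \<bullet> s (inverse c) y)"
proof -
  have "s c x \<bullet> s c z = (norm c)\<^sup>2 * (x \<bullet> z)" for z
    unfolding dot_norm normed_scaling_simps(1)[OF s, symmetric] normed_scaling_simps(7)[OF s]
    by (simp add: power_mult_distrib algebra_simps)
  from this[of "s (inverse c) y"] show ?thesis
    by (simp add: normed_scaling_simps[OF s] assms(2))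
qed

lemma inner_adj:
  fixes T :: "'a::{real_inner,banach} \<Rightarrow>\<^sub>L 'b::real_inner"
  shows "adj T y \<bullet> x = y \<bullet> T x"
  by (subst (1 2) inner_commute) (rule adj_inner[symmetric])

text \<open>Since \<open>T\<close> commutes with scalars, its adjoint commutes with their adjoints,
  which are scalars again. So the real adjoint respects the scalar field.\<close>

lemma adj_scaling:
  fixes T :: "'a::{real_inner,banach} \<Rightarrow>\<^sub>L 'b::real_inner" and s :: "'k::real_normed_field \<Rightarrow> 'a \<Rightarrow> 'a"
  assumes s: "normed_scaling s" "normed_scaling s'" and T: "\<And>c x. T (s c x) = s' c (T x)"
  shows "adj T (s' c y) = s c (adj T y)"
proof (cases "c = 0")
  case False
  show ?thesis
  proof (rule vector_eq_rdot[THEN iffD1], rule allI)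
    fix x
    have "adj T (s' c y) \<bullet> x = s' c y \<bullet> T x"
      by (simp only: inner_adj)
    also have "\<dots> = (norm c)\<^sup>2 * (y \<bullet> T (s (inverse c) x))"
      by (simp add: normed_scaling_inner[OF s(2) False] T)
    also have "\<dots> = (norm c)\<^sup>2 * (adj T y \<bullet> s (inverse c) x)"
      by (simp only: inner_adj)
    also have "\<dots> = s c (adj T y) \<bullet> x"
      by (simp add: normed_scaling_inner[OF s(1) False])
    finally show "adj T (s' c y) \<bullet> x = s c (adj T y) \<bullet> x" .
  qed
qed (simp add: normed_scaling_simps[OF s(1)] normed_scaling_simps[OF s(2)])

text \<open>Orthogonality is that of the real inner product; a scalar \<open>c\<close> moves across
  it as a multiple of \<open>inverse c\<close>, under which \<open>S\<close> is invariant.\<close>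

lemma subspace_orthogonal_comp_scaling:
  fixes s :: "'k::real_normed_field \<Rightarrow> 'a::real_inner \<Rightarrow> 'a"
  assumes s: "normed_scaling s" and S: "module.subspace s S"
  shows "module.subspace s (S\<^sup>\<bottom>)"
  unfolding subspace_normed_scaling_iff[OF s]
proof (intro conjI ballI allI)
  fix c x assume x: "x \<in> S\<^sup>\<bottom>"
  have "u \<bullet> s c x = 0" if "u \<in> S" for u
  proof (cases "c = 0")
    case False
    have "s (inverse c) u \<in> S" using S that by (simp add: subspace_normed_scaling_iff[OF s])
    then have "s (inverse c) u \<bullet> x = 0"
      using x by (simp add: orthogonal_comp_def orthogonal_def)
    then have "s c x \<bullet> u = 0"
      by (simp add: normed_scaling_inner[OF s False] inner_commute[of x])
    then show ?thesis by (simp only: inner_commute[of u])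
  qed (simp add: normed_scaling_simps[OF s])
  then show "s c x \<in> S\<^sup>\<bottom>"
    by (simp add: orthogonal_comp_def orthogonal_def)
qed (auto simp: orthogonal_comp_def orthogonal_def inner_add_right)

lemma closed_orthogonal_comp: "closed (S\<^sup>\<bottom>)"
proof -
  have "S\<^sup>\<bottom> = (\<Inter>y\<in>S. {x. y \<bullet> x = 0})"
    by (auto simp: orthogonal_comp_def orthogonal_def)
  also have "closed \<dots>"
    by (intro closed_INT ballI closed_Collect_eq continuous_intros)
  finally show ?thesis .
qed

lemma complemented_if_closed:
  fixes s :: "'k::real_normed_field \<Rightarrow> 'a::{real_inner,banach} \<Rightarrow> 'a"
  assumes s: "normed_scaling s" and S: "module.subspace s S" "closed S"
  shows "complemented s S"
  unfolding complemented_def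
proof (intro exI[of _ "S\<^sup>\<bottom>"] conjI)
  show "module.subspace s (S\<^sup>\<bottom>)"
    by (rule subspace_orthogonal_comp_scaling[OF s S(1)])
  show "closed (S\<^sup>\<bottom>)" by (rule closed_orthogonal_comp)
  show "S \<inter> S\<^sup>\<bottom> = {0}"
    using S(1) unfolding subspace_normed_scaling_iff[OF s]
    by (auto simp: orthogonal_comp_def orthogonal_def)
  have "\<exists>u z. x = u + z \<and> u \<in> S \<and> z \<in> S\<^sup>\<bottom>" for x
  proof -
    obtain u where "u \<in> S" "\<And>w. w \<in> S \<Longrightarrow> (x - u) \<bullet> w = 0"
      by (rule orthogonal_decomposition[OF S(2) subspace_scaleR_normed_scaling[OF s S(1)], where x = x]) blast
    then show ?thesis
      by (intro exI[of _ u] exI[of _ "x - u"])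
        (auto simp: orthogonal_comp_def orthogonal_def inner_commute)
  qed
  then show "{u + z |u z. u \<in> S \<and> z \<in> S\<^sup>\<bottom>} = UNIV" by blast
qed

text \<open>\<open>u\<close> below is only an algebraic projection. The seminorm \<open>x \<mapsto> sup \<parallel>T i (u x)\<parallel>\<close> is countably
  subadditive because the complement is closed; its boundedness is both claims at once.\<close>

lemma complemented_bounded_orbits_projection:
  fixes T :: "'i \<Rightarrow> 'a::banach \<Rightarrow>\<^sub>L 'a" and s :: "'k::real_normed_field \<Rightarrow> 'a \<Rightarrow> 'a"
  assumes s: "normed_scaling s"
    and T: "\<And>i c x. i \<in> I \<Longrightarrow> T i (s c x) = s c (T i x)"
    and i0: "i0 \<in> I" "T i0 = id_blinfun"
    and compl: "complemented s {v. bdd_above ((\<lambda>i. norm (T i v)) ` I)}" (is "complemented s ?U")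
  obtains R :: "'a \<Rightarrow>\<^sub>L 'a" and C where "\<And>c x. R (s c x) = s c (R x)" "\<And>x. bdd_above ((\<lambda>i. norm (T i (R x))) ` I)"
    "\<And>v. bdd_above ((\<lambda>i. norm (T i v)) ` I) \<Longrightarrow> R v = v"
    "0 \<le> C" "\<And>i. i \<in> I \<Longrightarrow> norm (T i o\<^sub>L R) \<le> C"
proof -
  obtain Z where Z: "module.subspace s Z" "closed Z" "?U \<inter> Z = {0}"
      "{u + z |u z. u \<in> ?U \<and> z \<in> Z} = UNIV"
    using compl by (auto simp: complemented_def)
  have Zsub: "subspace Z" by (rule subspace_scaleR_normed_scaling[OF s Z(1)])
  have bddD: "\<exists>M. \<forall>i\<in>I. norm (T i x) \<le> M" if "bdd_above ((\<lambda>i. norm (T i x)) ` I)" for x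
    using that by (simp add: bdd_above_def)
  have U: "module.subspace s ?U"
    unfolding subspace_normed_scaling_iff[OF s]
  proof (intro conjI ballI allI; unfold mem_Collect_eq)
    show "bdd_above ((\<lambda>i. norm (T i 0)) ` I)"
      by (rule bdd_aboveI2[of _ _ 0]) simp
  next
    fix x y assume "bdd_above ((\<lambda>i. norm (T i x)) ` I)" "bdd_above ((\<lambda>i. norm (T i y)) ` I)"
    then obtain M N where "\<forall>i\<in>I. norm (T i x) \<le> M" "\<forall>i\<in>I. norm (T i y) \<le> N"
      using bddD by blast
    then show "bdd_above ((\<lambda>i. norm (T i (x + y))) ` I)"
      by (intro bdd_aboveI2[of _ _ "M + N"]) (simp add: blinfun.add_right norm_triangle_mono)
  next
    fix c x assume "bdd_above ((\<lambda>i. norm (T i x)) ` I)"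
    then obtain M where "\<forall>i\<in>I. norm (T i x) \<le> M"
      using bddD by blast
    then show "bdd_above ((\<lambda>i. norm (T i (s c x))) ` I)"
      by (intro bdd_aboveI2[of _ _ "norm c * M"])
        (simp add: T normed_scaling_simps[OF s] mult_left_mono)
  qed
  have Usub: "subspace ?U" by (rule subspace_scaleR_normed_scaling[OF s U])
  have "\<exists>u. u \<in> ?U \<and> x - u \<in> Z" for x
  proof -
    have "x \<in> {u + z |u z. u \<in> ?U \<and> z \<in> Z}" unfolding Z(4) by (rule UNIV_I)
    then obtain v z where "x = v + z" "v \<in> ?U" "z \<in> Z"
      unfolding mem_Collect_eq[of x] by (elim exE conjE)
    then show ?thesis by (intro exI[of _ v]) simp
  qed
  then obtain u where u: "\<And>x. u x \<in> ?U" "\<And>x. x - u x \<in> Z" by metis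
  \<comment> \<open>The sum is direct, so two memberships identify \<open>u x\<close>; linearity of
    \<open>u\<close> and the passage to limits below rest on this.\<close>
  have unique: "u x = v" if "v \<in> ?U" "x - v \<in> Z" for x v
  proof -
    have "u x - v \<in> ?U" using u(1) that(1) Usub by (rule subspace_diff[rotated])
    moreover have "(x - v) - (x - u x) \<in> Z" using that(2) u(2) Zsub by (rule subspace_diff[rotated])
    ultimately have "u x - v \<in> ?U \<inter> Z" by simp
    then show ?thesis unfolding Z(3) by simp
  qed
  have u_add: "u (x + y) = u x + u y" for x y
  proof (rule unique)
    show "u x + u y \<in> ?U" using Usub u(1) u(1) by (rule subspace_add)
    have "(x - u x) + (y - u y) \<in> Z" using Zsub u(2) u(2) by (rule subspace_add)
    then show "x + y - (u x + u y) \<in> Z" by (simp add: algebra_simps)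
  qed
  have u_scale: "u (s c x) = s c (u x)" for c x
  proof (rule unique)
    show "s c (u x) \<in> ?U" by (rule subspace_scaling[OF s U u(1)])
    have "s c (x - u x) \<in> Z" by (rule subspace_scaling[OF s Z(1) u(2)])
    then show "s c x - s c (u x) \<in> Z" by (simp add: normed_scaling_simps[OF s])
  qed
  have u_scaleR: "u (r *\<^sub>R x) = r *\<^sub>R u x" for r x
    using u_scale[of "of_real r" x] by (simp add: normed_scaling_simps[OF s])
  define p where "p x = (SUP i\<in>I. norm (T i (u x)))" for x
  have le_p: "norm (T i (u x)) \<le> p x" if "i \<in> I" for i x
    unfolding p_def by (rule cSUP_upper[OF that]) (use u(1) in simp)
  have p_le: "p x \<le> M" if "\<And>i. i \<in> I \<Longrightarrow> norm (T i (u x)) \<le> M" for x M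
    unfolding p_def using i0 that by (intro cSUP_least) auto
  \<comment> \<open>The index \<open>i0\<close>, where \<open>T\<close> is the identity, makes
    \<open>p\<close> dominate the norm of the projection itself.\<close>
  have u_le: "norm (u x) \<le> p x" for x
    using le_p[OF i0(1), of x] by (simp add: i0)
  have p_scale_le: "p (r *\<^sub>R x) \<le> \<bar>r\<bar> * p x" for r x
    by (rule p_le) (simp add: u_scaleR blinfun.scaleR_right mult_left_mono le_p)
  have p_scale: "p (r *\<^sub>R x) = \<bar>r\<bar> * p x" for r x
  proof (cases "r = 0")
    case True
    then show ?thesis using p_scale_le[of 0 x] order_trans[OF norm_ge_zero u_le, of "0 *\<^sub>R x"] by simp
  next
    case False
    then have "p x \<le> \<bar>inverse r\<bar> * p (r *\<^sub>R x)"
      using p_scale_le[of "inverse r" "r *\<^sub>R x"] by simp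
    then have "\<bar>r\<bar> * p x \<le> p (r *\<^sub>R x)"
      using False by (simp add: field_simps abs_inverse)
    then show ?thesis using p_scale_le[of r x] by simp
  qed
  \<comment> \<open>The series of \<open>u (f n)\<close> converges absolutely since \<open>p\<close>
    dominates its terms. Its sum \<open>v\<close> has a bounded orbit, and the remainder stays in
    the closed space \<open>Z\<close>, so \<open>unique\<close> identifies \<open>v\<close> as the
    projection of the sum.\<close>
  have csub: "p (\<Sum>n. f n) \<le> (\<Sum>n. p (f n))"
    if f: "summable f" and pf: "summable (\<lambda>n. p (f n))" for f
  proof -
    have su: "summable (\<lambda>n. u (f n))"
      by (rule summable_comparison_test'[OF pf]) (rule u_le)
    define v where "v = (\<Sum>n. u (f n))"
    have Tv: "norm (T i v) \<le> (\<Sum>n. p (f n))" if "i \<in> I" for i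
    proof -
      have sT: "summable (\<lambda>n. norm (T i (u (f n))))"
        by (rule summable_comparison_test'[OF pf]) (simp add: le_p that)
      have "T i v = (\<Sum>n. T i (u (f n)))"
        unfolding v_def by (rule bounded_linear.suminf[OF blinfun.bounded_linear_right su])
      also have "norm \<dots> \<le> (\<Sum>n. norm (T i (u (f n))))"
        by (rule summable_norm[OF sT])
      also have "\<dots> \<le> (\<Sum>n. p (f n))"
        by (intro suminf_le sT pf le_p that)
      finally show ?thesis .
    qed
    have "u (\<Sum>n. f n) = v"
    proof (rule unique)
      show "v \<in> ?U" using Tv by (auto intro!: bdd_aboveI2)
      have "(\<lambda>n. f n - u (f n)) sums ((\<Sum>n. f n) - v)"
        unfolding v_def by (intro sums_diff summable_sums f su)
      then have lim: "(\<lambda>n. \<Sum>k<n. f k - u (f k)) \<longlonglongrightarrow> (\<Sum>n. f n) - v"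
        by (simp add: sums_def)
      have "(\<Sum>k<n. f k - u (f k)) \<in> Z" for n
        using Zsub u(2) by (rule subspace_sum)
      then show "(\<Sum>n. f n) - v \<in> Z"
        using closed_sequentially[OF Z(2) _ lim] by blast
    qed
    then show ?thesis using Tv by (intro p_le) simp
  qed
  obtain C where C: "0 \<le> C" "\<And>x. p x \<le> C * norm x"
    by (rule Zabreiko_seminorm_bound[of p, OF p_scale csub]) blast+
  have "bounded_linear u"
    by (rule bounded_linear_intro[of _ C])
      (use u_add u_scaleR order_trans[OF u_le C(2)] in \<open>auto simp: mult.commute\<close>)
  then have app: "blinfun_apply (Blinfun u) = u" by (rule bounded_linear_Blinfun_apply)
  show thesis
  proof (rule that[of "Blinfun u" C])
    show "0 \<le> C" by fact
    show "norm (T i o\<^sub>L Blinfun u) \<le> C" if "i \<in> I" for i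
      by (rule norm_blinfun_bound[OF C(1)]) (simp add: app order_trans[OF le_p[OF that] C(2)])
    show "blinfun_apply (Blinfun u) v = v" if "bdd_above ((\<lambda>i. norm (T i v)) ` I)" for v
      unfolding app by (rule unique) (use that subspace_0[OF Zsub] in auto)
    show "blinfun_apply (Blinfun u) (s c x) = s c (blinfun_apply (Blinfun u) x)" for c x
      unfolding app by (rule u_scale)
    show "bdd_above ((\<lambda>i. norm (T i (blinfun_apply (Blinfun u) x))) ` I)" for x
      unfolding app using u(1) by simp
  qed
qed

section \<open>From Green bounds to an invariant splitting\<close>

text \<open>Abstract two-sided evolutions, so that the transposed family
  \<open>\<lambda>m n. adj (\<Phi> n m)\<close> is covered too. The indices come in any order, hence
  \<Phi> n m inverts \<Phi> m n.\<close>

definition cocycle :: "(int \<Rightarrow> int \<Rightarrow> 'a::real_normed_vector \<Rightarrow>\<^sub>L 'a) \<Rightarrow> bool" where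
  "cocycle \<Phi> \<longleftrightarrow> (\<forall>n\<le>0. \<Phi> n n = id_blinfun) \<and>
     (\<forall>m\<le>0. \<forall>k\<le>0. \<forall>n\<le>0. \<Phi> m k o\<^sub>L \<Phi> k n = \<Phi> m n)"

text \<open>The estimates of a dichotomy without its algebra: \<open>p n\<close> may fail to be a
  projection or to be invariant, as for a corner of the projections of a triangular system.\<close>

definition green_bounds ::
  "(int \<Rightarrow> int \<Rightarrow> 'a::real_normed_vector \<Rightarrow>\<^sub>L 'a) \<Rightarrow> (int \<Rightarrow> 'a \<Rightarrow>\<^sub>L 'a) \<Rightarrow> real \<Rightarrow> real \<Rightarrow> bool" where
  "green_bounds \<Phi> p K \<alpha> \<longleftrightarrow> (\<forall>n m. n \<le> m \<and> m \<le> 0 \<longrightarrow>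
     norm (\<Phi> m n o\<^sub>L p n) \<le> K * exp (- \<alpha> * real_of_int (m - n)) \<and>
     norm (\<Phi> n m o\<^sub>L (id_blinfun - p m)) \<le> K * exp (- \<alpha> * real_of_int (m - n)))"

text \<open>The algebra of a dichotomy; for a cocycle, commutation already makes \<Phi> bijective
  between kernels.\<close>

definition invariant_splitting ::
  "('k \<Rightarrow> 'a \<Rightarrow> 'a) \<Rightarrow> (int \<Rightarrow> int \<Rightarrow> 'a::real_normed_vector \<Rightarrow>\<^sub>L 'a) \<Rightarrow> (int \<Rightarrow> 'a \<Rightarrow>\<^sub>L 'a) \<Rightarrow> bool" where
  "invariant_splitting s \<Phi> Q \<longleftrightarrow>
     (\<forall>n\<le>0. Q n o\<^sub>L Q n = Q n \<and> (\<forall>c x. Q n (s c x) = s c (Q n x))) \<and>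
     (\<forall>m\<le>0. \<forall>n\<le>0. \<Phi> m n o\<^sub>L Q n = Q m o\<^sub>L \<Phi> m n)"

lemma green_boundsI:
  fixes \<Phi> :: "int \<Rightarrow> int \<Rightarrow> 'a::real_normed_vector \<Rightarrow>\<^sub>L 'a" and p :: "int \<Rightarrow> 'a \<Rightarrow>\<^sub>L 'a"
  assumes "0 \<le> K"
    and "\<And>n m x. n \<le> m \<Longrightarrow> m \<le> 0 \<Longrightarrow> norm (\<Phi> m n (p n x)) \<le> K * exp (- \<alpha> * real_of_int (m - n)) * norm x"
    and "\<And>n m x. n \<le> m \<Longrightarrow> m \<le> 0 \<Longrightarrow> norm (\<Phi> n m (x - p m x)) \<le> K * exp (- \<alpha> * real_of_int (m - n)) * norm x"
  shows "green_bounds \<Phi> p K \<alpha>"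
  unfolding green_bounds_def using assms
  by (auto intro!: norm_blinfun_bound simp: blinfun.diff_left)

lemma green_boundsD:
  fixes \<Phi> :: "int \<Rightarrow> int \<Rightarrow> 'a::real_normed_vector \<Rightarrow>\<^sub>L 'a" and p :: "int \<Rightarrow> 'a \<Rightarrow>\<^sub>L 'a"
  assumes "green_bounds \<Phi> p K \<alpha>" "n \<le> m" "m \<le> 0"
  shows "norm (\<Phi> m n (p n x)) \<le> K * exp (- \<alpha> * real_of_int (m - n)) * norm x"
    and "norm (\<Phi> n m (x - p m x)) \<le> K * exp (- \<alpha> * real_of_int (m - n)) * norm x"
proof -
  have "norm ((\<Phi> m n o\<^sub>L p n) x) \<le> K * exp (- \<alpha> * real_of_int (m - n)) * norm x"
    using assms by (intro norm_blinfun[THEN order_trans] mult_right_mono) (auto simp: green_bounds_def)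
  then show "norm (\<Phi> m n (p n x)) \<le> K * exp (- \<alpha> * real_of_int (m - n)) * norm x" by simp
  have "norm ((\<Phi> n m o\<^sub>L (id_blinfun - p m)) x) \<le> K * exp (- \<alpha> * real_of_int (m - n)) * norm x"
    using assms by (intro norm_blinfun[THEN order_trans] mult_right_mono) (auto simp: green_bounds_def)
  then show "norm (\<Phi> n m (x - p m x)) \<le> K * exp (- \<alpha> * real_of_int (m - n)) * norm x"
    by (simp add: blinfun.diff_left)
qed

lemma cocycleD:
  fixes \<Phi> :: "int \<Rightarrow> int \<Rightarrow> 'a::real_normed_vector \<Rightarrow>\<^sub>L 'a"
  assumes "cocycle \<Phi>"
  shows "n \<le> 0 \<Longrightarrow> \<Phi> n n = id_blinfun"
    and "m \<le> 0 \<Longrightarrow> k \<le> 0 \<Longrightarrow> n \<le> 0 \<Longrightarrow> \<Phi> m k (\<Phi> k n x) = \<Phi> m n x"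
  using assms by (auto simp: cocycle_def simp flip: blinfun_apply_blinfun_compose)

text \<open>Turns Green bounds into invariant projections with the same rate \<alpha>. The point is
  that orbits starting in the range of \<open>R\<close>, so far only bounded, actually decay
  backwards.\<close>

lemma splitting_of_green_bounds:
  fixes \<Phi> :: "int \<Rightarrow> int \<Rightarrow> 'a::banach \<Rightarrow>\<^sub>L 'a" and s :: "'k::real_normed_field \<Rightarrow> 'a \<Rightarrow> 'a"
  assumes s: "normed_scaling s"
    and coc: "cocycle \<Phi>"
    and lin: "\<And>m n c x. m \<le> 0 \<Longrightarrow> n \<le> 0 \<Longrightarrow> \<Phi> m n (s c x) = s c (\<Phi> m n x)"
    and green: "green_bounds \<Phi> p K \<alpha>" and K: "0 < K" and \<alpha>: "0 < \<alpha>"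
    and compl: "complemented s {v. bdd_above ((\<lambda>n. norm (\<Phi> n 0 v)) ` {..0})}"
  obtains Q :: "int \<Rightarrow> 'a \<Rightarrow>\<^sub>L 'a" and L where "0 < L" "invariant_splitting s \<Phi> Q" "green_bounds \<Phi> Q L \<alpha>"
proof -
  note [simp] = cocycleD[OF coc]
  obtain R :: "'a \<Rightarrow>\<^sub>L 'a" and C where R: "\<And>c x. R (s c x) = s c (R x)"
      "\<And>x. bdd_above ((\<lambda>n. norm (\<Phi> n 0 (R x))) ` {..0})"
      "\<And>v. bdd_above ((\<lambda>n. norm (\<Phi> n 0 v)) ` {..0}) \<Longrightarrow> R v = v"
      and C: "0 \<le> C" "\<And>n. n \<in> {..0} \<Longrightarrow> norm (\<Phi> n 0 o\<^sub>L R) \<le> C"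
    by (rule complemented_bounded_orbits_projection[OF s _ _ _ compl, where ?i0.0 = 0]) (auto simp: lin)
  have RR: "R (R x) = R x" for x by (rule R(3)[OF R(2)])
  define a where "a n = norm (\<Phi> n 0 o\<^sub>L R)" for n
  have a: "norm (\<Phi> n 0 (R x)) \<le> a n * norm x" for n x
    unfolding a_def using norm_blinfun[of "\<Phi> n 0 o\<^sub>L R" x] by simp
  have a_nonneg: "0 \<le> a n" for n by (simp add: a_def)
  have a_le: "a n \<le> C" if "n \<le> 0" for n using C(2) that by (simp add: a_def)
  \<comment> \<open>Before \<open>n\<close> the Green bound controls this orbit, and from
    \<open>n\<close> to 0 there are only finitely many times.\<close>
  have fixed: "R (\<Phi> 0 n (x - p n x)) = \<Phi> 0 n (x - p n x)" if n: "n \<le> 0" for n x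
  proof (rule R(3))
    have "{..0} = {..n} \<union> {n..0}" using n by auto
    moreover have "bdd_above ((\<lambda>k. norm (\<Phi> k 0 (\<Phi> 0 n (x - p n x)))) ` {..n})"
    proof (rule bdd_aboveI2)
      fix k assume "k \<in> {..n}"
      then have k: "k \<le> n" by simp
      have "norm (\<Phi> k 0 (\<Phi> 0 n (x - p n x))) = norm (\<Phi> k n (x - p n x))"
        using k n by simp
      also have "\<dots> \<le> K * exp (- \<alpha> * real_of_int (n - k)) * norm x"
        by (rule green_boundsD[OF green k n])
      also have "\<dots> \<le> K * 1 * norm x"
        using K \<alpha> k by (intro mult_right_mono mult_left_mono) auto
      finally show "norm (\<Phi> k 0 (\<Phi> 0 n (x - p n x))) \<le> K * 1 * norm x" .
    qed
    ultimately show "bdd_above ((\<lambda>k. norm (\<Phi> k 0 (\<Phi> 0 n (x - p n x)))) ` {..0})"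
      by (simp add: image_Un)
  qed
  \<comment> \<open>Split \<open>w\<close> into \<open>w - p n w\<close> and \<open>p n w\<close>.
    The second part is carried to time 0 with the small factor \<open>exp (\<alpha> * n)\<close>;
    there it is a difference of vectors fixed by \<open>R\<close>, so \<open>a k\<close> controls
    the way back.\<close>
  have step: "norm (\<Phi> k n w) \<le> (K * exp (- \<alpha> * real_of_int (n - k)) + a k * (K * exp (\<alpha> * n))) * norm w"
    if kn: "k \<le> n" "n \<le> 0" and w: "R (\<Phi> 0 n w) = \<Phi> 0 n w" for k n w
  proof -
    have "\<Phi> 0 n (p n w) = R (\<Phi> 0 n (p n w))"
      using fixed[OF kn(2), of w] w by (simp add: blinfun.diff_right)
    then have "\<Phi> k n w = \<Phi> k n (w - p n w) + \<Phi> k 0 (R (\<Phi> 0 n (p n w)))"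
      using kn by (metis blinfun.add_right cocycleD(2)[OF coc] diff_add_cancel order.refl order_trans)
    also have "norm \<dots> \<le> K * exp (- \<alpha> * real_of_int (n - k)) * norm w + a k * (K * exp (\<alpha> * n) * norm w)"
    proof (rule norm_triangle_mono)
      show "norm (\<Phi> k n (w - p n w)) \<le> K * exp (- \<alpha> * real_of_int (n - k)) * norm w"
        by (rule green_boundsD[OF green kn])
      have "norm (\<Phi> k 0 (R (\<Phi> 0 n (p n w)))) \<le> a k * norm (\<Phi> 0 n (p n w))" by (rule a)
      also have "\<dots> \<le> a k * (K * exp (\<alpha> * n) * norm w)"
        using green_boundsD(1)[OF green kn(2), of w] by (intro mult_left_mono a_nonneg) simp
      finally show "norm (\<Phi> k 0 (R (\<Phi> 0 n (p n w)))) \<le> a k * (K * exp (\<alpha> * n) * norm w)" .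
    qed
    finally show ?thesis by (simp add: algebra_simps)
  qed
  have a_step: "a k \<le> (K * exp (- \<alpha> * real_of_int (n - k)) + a k * (K * exp (\<alpha> * n))) * a n"
    if kn: "k \<le> n" "n \<le> 0" for k n
    unfolding a_def[of k]
  proof (rule norm_blinfun_bound)
    fix x
    have "(\<Phi> k 0 o\<^sub>L R) x = \<Phi> k n (\<Phi> n 0 (R x))" using kn by simp
    also have "norm \<dots> \<le> (K * exp (- \<alpha> * real_of_int (n - k)) + a k * (K * exp (\<alpha> * n))) * norm (\<Phi> n 0 (R x))"
      using kn by (intro step) (simp_all add: RR)
    also have "\<dots> \<le> (K * exp (- \<alpha> * real_of_int (n - k)) + a k * (K * exp (\<alpha> * n))) * (a n * norm x)"
      using K a_nonneg by (intro mult_left_mono a) auto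
    finally show "norm ((\<Phi> k 0 o\<^sub>L R) x) \<le>
        (K * exp (- \<alpha> * real_of_int (n - k)) + norm (\<Phi> k 0 o\<^sub>L R) * (K * exp (\<alpha> * n))) * a n * norm x"
      by (simp add: a_def mult.assoc)
  qed (use K a_nonneg in auto)
  \<comment> \<open>\<open>a k\<close> occurs on both sides of \<open>a_step\<close>. Fix a time
    \<open>n\<close> with \<open>K * C * exp (\<alpha> * n) \<le> 1 / 2\<close>; then at most half
    of \<open>a k\<close> remains on the right and can be absorbed.\<close>
  obtain D where D: "0 \<le> D" "\<And>k. k \<le> 0 \<Longrightarrow> a k \<le> D * exp (\<alpha> * k)"
  proof -
    obtain N :: nat where N: "2 * K * C < real N * \<alpha>"
      using reals_Archimedean3[OF \<alpha>] by auto
    define n where "n = - int N"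
    have n: "n \<le> 0" by (simp add: n_def)
    have "2 * K * C \<le> exp (\<alpha> * N)"
      using N exp_ge_add_one_self[of "real N * \<alpha>"] unfolding mult.commute[of \<alpha>] by linarith
    then have half: "K * C * exp (\<alpha> * n) \<le> 1 / 2"
      by (simp add: n_def exp_minus field_simps)
    \<comment> \<open>One constant for both ranges of \<open>k\<close>: \<open>2 * K\<close> comes
      from the absorption for \<open>k \<le> n\<close>, and the added 1 covers the plain bound
      \<open>C\<close> for \<open>k > n\<close>.\<close>
    define D where "D = (2 * K + 1) * C * exp (- \<alpha> * n)"
    show thesis
    proof (rule that)
      show "0 \<le> D" using K C by (simp add: D_def)
      fix k :: int assume k: "k \<le> 0"
      show "a k \<le> D * exp (\<alpha> * k)"
      proof (cases "k \<le> n")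
        case True
        have "a k \<le> (K * exp (- \<alpha> * real_of_int (n - k)) + a k * (K * exp (\<alpha> * n))) * a n"
          by (rule a_step[OF True n])
        also have "\<dots> \<le> (K * exp (- \<alpha> * real_of_int (n - k)) + a k * (K * exp (\<alpha> * n))) * C"
          using K a_nonneg by (intro mult_left_mono a_le n) auto
        also have "\<dots> = K * C * exp (- \<alpha> * real_of_int (n - k)) + a k * (K * C * exp (\<alpha> * n))"
          by (simp add: algebra_simps)
        also have "\<dots> \<le> K * C * exp (- \<alpha> * real_of_int (n - k)) + a k * (1 / 2)"
          by (intro add_left_mono mult_left_mono half a_nonneg)
        finally have "a k \<le> 2 * K * C * exp (- \<alpha> * real_of_int (n - k))" by simp
        also have "\<dots> \<le> (2 * K + 1) * C * exp (- \<alpha> * real_of_int (n - k))"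
          using C K by (intro mult_right_mono) auto
        also have "exp (- \<alpha> * real_of_int (n - k)) = exp (- \<alpha> * n) * exp (\<alpha> * k)"
          by (simp add: algebra_simps flip: exp_add)
        finally show ?thesis by (simp add: D_def mult.assoc)
      next
        case False
        have "1 \<le> exp (\<alpha> * real_of_int (k - n))" using False \<alpha> by simp
        then have "C * 1 \<le> ((2 * K + 1) * C) * exp (\<alpha> * real_of_int (k - n))"
          using C K by (intro mult_mono) (auto simp: algebra_simps)
        also have "exp (\<alpha> * real_of_int (k - n)) = exp (- \<alpha> * n) * exp (\<alpha> * k)"
          by (simp add: algebra_simps flip: exp_add)
        finally show ?thesis using a_le[OF k] by (simp add: D_def mult.assoc)
      qed
    qed
  qed
  \<comment> \<open>For nonpositive times \<open>m + n\<close> is below both \<open>m - n\<close>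
    and \<open>n - m\<close>: a detour through time 0 decays at least as fast as required.\<close>
  have exp_le: "exp (\<alpha> * m) * exp (\<alpha> * n) \<le> exp (- \<alpha> * real_of_int (m - n))"
      "exp (\<alpha> * m) * exp (\<alpha> * n) \<le> exp (- \<alpha> * real_of_int (n - m))"
    if "m \<le> 0" "n \<le> 0" for m n :: int
    using that \<alpha> by (auto simp: algebra_simps mult_le_0_iff simp flip: exp_add)
  \<comment> \<open>\<open>id_blinfun - R\<close> transported from time 0 to time \<open>n\<close>,
    which makes it commute with \<Phi>.\<close>
  define Q where "Q n = id_blinfun - (\<Phi> n 0 o\<^sub>L R o\<^sub>L \<Phi> 0 n)" for n
  \<comment> \<open>By \<open>fixed\<close>, \<open>Q n\<close> annihilates
    \<open>x - p n x\<close>, so \<open>Q n x = Q n (p n x)\<close>; this brings in the forward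
    bound of \<open>p\<close>.\<close>
  have Q_p: "Q n x = p n x - \<Phi> n 0 (R (\<Phi> 0 n (p n x)))" if "n \<le> 0" for n x
    using arg_cong[OF fixed[OF that, of x], of "\<Phi> n 0"] that
    by (simp add: Q_def blinfun.diff_right blinfun.diff_left algebra_simps)
  have Q1: "norm (\<Phi> m n (Q n x)) \<le> K * (1 + D) * exp (- \<alpha> * real_of_int (m - n)) * norm x"
    if mn: "n \<le> m" "m \<le> 0" for m n x
  proof -
    have n: "n \<le> 0" using mn by simp
    have "norm (\<Phi> m 0 (R (\<Phi> 0 n (p n x)))) \<le> a m * norm (\<Phi> 0 n (p n x))" by (rule a)
    also have "\<dots> \<le> (D * exp (\<alpha> * m)) * (K * exp (\<alpha> * n) * norm x)"
      using green_boundsD(1)[OF green n, of x] D mn by (intro mult_mono) auto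
    also have "\<dots> = D * K * (exp (\<alpha> * m) * exp (\<alpha> * n)) * norm x" by simp
    also have "\<dots> \<le> D * K * exp (- \<alpha> * real_of_int (m - n)) * norm x"
      using D K mn n by (intro mult_right_mono mult_left_mono exp_le) auto
    finally have 1: "norm (\<Phi> m 0 (R (\<Phi> 0 n (p n x)))) \<le> D * K * exp (- \<alpha> * real_of_int (m - n)) * norm x" .
    have "\<Phi> m n (Q n x) = \<Phi> m n (p n x) - \<Phi> m 0 (R (\<Phi> 0 n (p n x)))"
      using mn n by (simp add: Q_p blinfun.diff_right)
    also have "norm \<dots> \<le> K * exp (- \<alpha> * real_of_int (m - n)) * norm x
        + D * K * exp (- \<alpha> * real_of_int (m - n)) * norm x"
      by (rule norm_triangle_le_diff[OF add_mono[OF green_boundsD(1)[OF green mn] 1]])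
    finally show ?thesis by (simp add: algebra_simps)
  qed
  define B where "B = K * (1 + D)"
  have B: "0 < B" using K D by (simp add: B_def)
  \<comment> \<open>\<open>step\<close> applies to \<open>x - Q m x\<close>, now with the decay of
    \<open>a\<close> inserted. \<open>Q1\<close> at equal times bounds the norm of this vector,
    whence the factor \<open>1 + B\<close>.\<close>
  have Q2: "norm (\<Phi> n m (x - Q m x)) \<le> B * (1 + B) * exp (- \<alpha> * real_of_int (m - n)) * norm x"
    if nm: "n \<le> m" "m \<le> 0" for m n x
  proof -
    define w where "w = x - Q m x"
    have w: "w = \<Phi> m 0 (R (\<Phi> 0 m x))" by (simp add: w_def Q_def blinfun.diff_left)
    have n: "n \<le> 0" using nm by simp
    have "norm w \<le> norm x + norm (Q m x)" unfolding w_def by (rule norm_triangle_ineq4)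
    also have "\<dots> \<le> (1 + B) * norm x"
      using Q1[of m m x] nm by (simp add: B_def algebra_simps)
    finally have wx: "norm w \<le> (1 + B) * norm x" .
    have "norm (\<Phi> n m w) \<le> (K * exp (- \<alpha> * real_of_int (m - n)) + a n * (K * exp (\<alpha> * m))) * norm w"
      by (rule step[OF nm]) (use nm in \<open>simp add: w RR\<close>)
    also have "\<dots> \<le> (K * exp (- \<alpha> * real_of_int (m - n)) + D * exp (\<alpha> * n) * (K * exp (\<alpha> * m))) * norm w"
      using D(2)[OF n] K by (intro mult_right_mono add_left_mono) auto
    also have "\<dots> = (K * exp (- \<alpha> * real_of_int (m - n)) + D * K * (exp (\<alpha> * n) * exp (\<alpha> * m))) * norm w"
      by (simp add: algebra_simps)
    also have "\<dots> \<le> (K * exp (- \<alpha> * real_of_int (m - n)) + D * K * exp (- \<alpha> * real_of_int (m - n))) * norm w"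
      using D K nm n by (intro mult_right_mono add_left_mono mult_left_mono exp_le) auto
    also have "\<dots> = B * exp (- \<alpha> * real_of_int (m - n)) * norm w"
      by (simp add: B_def algebra_simps)
    also have "\<dots> \<le> B * exp (- \<alpha> * real_of_int (m - n)) * ((1 + B) * norm x)"
      using B by (intro mult_left_mono wx) auto
    finally show ?thesis by (simp add: w_def mult_ac)
  qed
  show thesis
  proof (rule that)
    show "0 < B * (1 + B)" using B by simp
    show "invariant_splitting s \<Phi> Q"
      unfolding invariant_splitting_def
      by (auto intro!: blinfun_eqI simp: Q_def blinfun.diff_right blinfun.diff_left RR R lin
          normed_scaling_simps[OF s])
    show "green_bounds \<Phi> Q (B * (1 + B)) \<alpha>"
    proof (rule green_boundsI)
      fix n m :: int and x assume nm: "n \<le> m" "m \<le> 0"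
      have "norm (\<Phi> m n (Q n x)) \<le> B * exp (- \<alpha> * real_of_int (m - n)) * norm x"
        using Q1[OF nm] by (simp add: B_def)
      also have "\<dots> \<le> B * (1 + B) * exp (- \<alpha> * real_of_int (m - n)) * norm x"
        using B by (intro mult_right_mono) auto
      finally show "norm (\<Phi> m n (Q n x)) \<le> B * (1 + B) * exp (- \<alpha> * real_of_int (m - n)) * norm x" .
    qed (use B Q2 in auto)
  qed
qed

section \<open>Evolution operators and dichotomies\<close>

lemma transition_refl [simp]: "transition A n n = id_blinfun"
  by (simp add: transition_def)

lemma transition_Suc: "n \<le> m \<Longrightarrow> transition A (m + 1) n = A m o\<^sub>L transition A m n"
proof -
  assume "n \<le> m"
  then have "nat (m + 1 - n) = Suc (nat (m - n))" by simp
  with \<open>n \<le> m\<close> show ?thesis by (simp add: transition_def)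
qed

lemma transition_comp:
  assumes "n \<le> k" "k \<le> m"
  shows "transition A m k (transition A k n x) = transition A m n x"
  using assms(2)
proof (induction m rule: int_ge_induct)
  case (step m)
  then show ?case using assms(1) by (simp add: transition_Suc)
qed simp

text \<open>For \<open>f\<close> a coordinate map, an embedding of a factor or a scalar
  multiplication. Negative times suffice, since the last coefficient applied is
  \<open>A (m - 1)\<close>.\<close>

lemma transition_intertwine:
  fixes A :: "int \<Rightarrow> 'a::real_normed_vector \<Rightarrow>\<^sub>L 'a" and B :: "int \<Rightarrow> 'b::real_normed_vector \<Rightarrow>\<^sub>L 'b"
  assumes "n \<le> m" "m \<le> 0" and f: "\<And>k x. k < 0 \<Longrightarrow> f (A k x) = B k (f x)"
  shows "f (transition A m n x) = transition B m n (f x)"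
  using assms(1,2)
proof (induction m rule: int_ge_induct)
  case (step m)
  then show ?case by (simp add: transition_Suc f)
qed simp

section \<open>Inverses and the two-sided evolution\<close>

lemma blinfun_eq_iff: "S = T \<longleftrightarrow> (\<forall>x. blinfun_apply S x = blinfun_apply T x)"
  by (auto intro: blinfun_eqI)

text \<open>The inverse as a bounded operator rather than a plain function, so that it can be
  composed and transposed.\<close>

definition blinfun_inv :: "('a::real_normed_vector \<Rightarrow>\<^sub>L 'b::real_normed_vector) \<Rightarrow> 'b \<Rightarrow>\<^sub>L 'a" where
  "blinfun_inv T = (SOME S. S o\<^sub>L T = id_blinfun \<and> T o\<^sub>L S = id_blinfun)"

lemma blinfun_inv:
  fixes T :: "'a::real_normed_vector \<Rightarrow>\<^sub>L 'b::real_normed_vector"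
  assumes "invertible_blinfun T"
  shows "blinfun_inv T (T x) = x" "T (blinfun_inv T y) = y"
proof -
  have "blinfun_inv T o\<^sub>L T = id_blinfun \<and> T o\<^sub>L blinfun_inv T = id_blinfun"
    using assms unfolding invertible_blinfun_def blinfun_inv_def by (rule someI_ex)
  then show "blinfun_inv T (T x) = x" "T (blinfun_inv T y) = y"
    by (metis blinfun_apply_blinfun_compose blinfun_apply_id_blinfun)+
qed

lemma invertible_blinfunI:
  fixes T :: "'a::real_normed_vector \<Rightarrow>\<^sub>L 'b::real_normed_vector" and S :: "'b \<Rightarrow>\<^sub>L 'a"
  assumes "\<And>x. S (T x) = x" "\<And>y. T (S y) = y"
  shows "invertible_blinfun T"
  unfolding invertible_blinfun_def using assms by (intro exI[of _ S]) (auto intro!: blinfun_eqI)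

lemma invertible_transition:
  assumes "n \<le> m" "m \<le> 0" and A: "\<And>k. k \<le> 0 \<Longrightarrow> invertible_blinfun (A k)"
  shows "invertible_blinfun (transition A m n)"
  using assms(1,2)
proof (induction m rule: int_ge_induct)
  case base
  then show ?case by (intro invertible_blinfunI[of id_blinfun]) auto
next
  case (step m)
  then show ?case
    by (intro invertible_blinfunI[of "blinfun_inv (transition A m n) o\<^sub>L blinfun_inv (A m)"])
      (auto simp: transition_Suc blinfun_inv A)
qed

text \<open>The detour through time 0 gives one formula for both orders of \<open>m\<close> and
  \<open>n\<close> and makes the cocycle law a cancellation.\<close>

definition evolution :: "(int \<Rightarrow> 'a::real_normed_vector \<Rightarrow>\<^sub>L 'a) \<Rightarrow> int \<Rightarrow> int \<Rightarrow> 'a \<Rightarrow>\<^sub>L 'a" where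
  "evolution A m n = blinfun_inv (transition A 0 m) o\<^sub>L transition A 0 n"

context
  fixes A :: "int \<Rightarrow> 'a::real_normed_vector \<Rightarrow>\<^sub>L 'a"
  assumes A: "\<And>k. k \<le> 0 \<Longrightarrow> invertible_blinfun (A k)"
begin

lemma cocycle_evolution: "cocycle (evolution A)"
  unfolding cocycle_def
  by (auto intro!: blinfun_eqI simp: evolution_def blinfun_inv invertible_transition A)

lemma evolution_forward: "n \<le> m \<Longrightarrow> m \<le> 0 \<Longrightarrow> evolution A m n = transition A m n"
  by (rule blinfun_eqI)
    (simp add: evolution_def transition_comp[symmetric, of n m 0] blinfun_inv invertible_transition A)

lemma full_transition_evolution:
  assumes "m \<le> 0" "n \<le> 0"
  shows "full_transition A m n = blinfun_apply (evolution A m n)"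
proof (cases "n \<le> m")
  case True
  then show ?thesis using assms by (simp add: full_transition_def evolution_forward)
next
  case False
  then have "inv (blinfun_apply (transition A n m)) = blinfun_apply (evolution A m n)"
    using assms cocycleD[OF cocycle_evolution]
    by (intro inv_unique_comp) (auto simp flip: evolution_forward)
  then show ?thesis using False by (simp add: full_transition_def)
qed

lemma evolution_scaling:
  assumes "\<And>n c x. n \<le> 0 \<Longrightarrow> A n (s c x) = s c (A n x)" "m \<le> 0" "n \<le> 0"
  shows "evolution A m n (s c x) = s c (evolution A m n x)"
proof -
  have T: "transition A 0 k (s c y) = s c (transition A 0 k y)" if "k \<le> 0" for k y
    by (rule transition_intertwine[OF that, symmetric]) (simp_all add: assms(1))
  have "transition A 0 m (s c (evolution A m n x)) = transition A 0 n (s c x)"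
    using assms by (simp add: T evolution_def blinfun_inv invertible_transition A)
  then show ?thesis
    using assms by (metis evolution_def blinfun_apply_blinfun_compose blinfun_inv(1) invertible_transition A order.refl)
qed

end

text \<open>The preimage \<open>y\<close> stands for the inverse of the transition operator between the kernels.\<close>

definition dichotomy_data ::
  "(int \<Rightarrow> 'a::real_normed_vector \<Rightarrow>\<^sub>L 'a) \<Rightarrow> (int \<Rightarrow> 'a \<Rightarrow>\<^sub>L 'a) \<Rightarrow> real \<Rightarrow> real \<Rightarrow> bool" where
  "dichotomy_data A P K \<alpha> \<longleftrightarrow> (\<forall>n m. n \<le> m \<and> m \<le> 0 \<longrightarrow>
     (\<forall>x. P m (P m x) = P m x \<and>
          transition A m n (P n x) = P m (transition A m n x) \<and>
          norm (transition A m n (P n x)) \<le> K * exp (- \<alpha> * real_of_int (m - n)) * norm x \<and>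
          (P n x = 0 \<longrightarrow> transition A m n x = 0 \<longrightarrow> x = 0) \<and>
          (\<exists>y. P n y = 0 \<and> transition A m n y = x - P m x \<and>
             norm y \<le> K * exp (- \<alpha> * real_of_int (m - n)) * norm x)))"

lemma dichotomy_dataD:
  fixes A :: "int \<Rightarrow> 'a::real_normed_vector \<Rightarrow>\<^sub>L 'a" and P :: "int \<Rightarrow> 'a \<Rightarrow>\<^sub>L 'a"
  assumes "dichotomy_data A P K \<alpha>" "n \<le> m" "m \<le> 0"
  shows "P m (P m x) = P m x"
    and "transition A m n (P n x) = P m (transition A m n x)"
    and "norm (transition A m n (P n x)) \<le> K * exp (- \<alpha> * real_of_int (m - n)) * norm x"
    and "P n x = 0 \<Longrightarrow> transition A m n x = 0 \<Longrightarrow> x = 0"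
    and "\<exists>y. P n y = 0 \<and> transition A m n y = x - P m x \<and>
             norm y \<le> K * exp (- \<alpha> * real_of_int (m - n)) * norm x"
  using assms unfolding dichotomy_data_def by blast+

text \<open>Eliminates \<open>inv_into\<close>. By induction the one-step bijections between kernels
  compose to a bijection for each transition; its injectivity and surjectivity become the last two
  clauses of the data.\<close>

lemma exp_dichotomy_data:
  fixes A :: "int \<Rightarrow> 'a::banach \<Rightarrow>\<^sub>L 'a" and s :: "'k::real_normed_field \<Rightarrow> 'a \<Rightarrow> 'a"
  assumes "exp_dichotomy s A"
  obtains P :: "int \<Rightarrow> 'a \<Rightarrow>\<^sub>L 'a" and K \<alpha> where "0 < K" "0 < \<alpha>" "dichotomy_data A P K \<alpha>"
    "\<And>n c x. n \<le> 0 \<Longrightarrow> P n (s c x) = s c (P n x)"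
proof -
  obtain P :: "int \<Rightarrow> 'a \<Rightarrow>\<^sub>L 'a" and K \<alpha> where K: "0 < K" "0 < \<alpha>"
    and P: "\<And>n. n \<le> 0 \<Longrightarrow> Vector_Spaces.linear s s (blinfun_apply (P n)) \<and> P n o\<^sub>L P n = P n"
    and A: "\<And>n. n < 0 \<Longrightarrow> A n o\<^sub>L P n = P (n + 1) o\<^sub>L A n \<and>
             bij_betw (blinfun_apply (A n)) (ker (P n)) (ker (P (n + 1)))"
    and fw: "\<And>n m. n \<le> m \<Longrightarrow> m \<le> 0 \<Longrightarrow>
             norm (transition A m n o\<^sub>L P n) \<le> K * exp (- \<alpha> * real_of_int (m - n))"
    and bw: "\<And>m n x. m \<le> n \<Longrightarrow> n \<le> 0 \<Longrightarrow>
             norm (inv_into (ker (P m)) (blinfun_apply (transition A n m)) (x - P n x))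
                    \<le> K * exp (- \<alpha> * real_of_int (n - m)) * norm x"
    using assms unfolding exp_dichotomy_def by metis
  have comm: "transition A m n (P n x) = P m (transition A m n x)" if "n \<le> m" "m \<le> 0" for n m x
    using that
  proof (induction m rule: int_ge_induct)
    case (step m)
    then have "A m (P m y) = P (m + 1) (A m y)" for y
      using A[of m] by (metis add1_zle_eq blinfun_apply_blinfun_compose)
    then show ?case using step by (simp add: transition_Suc)
  qed simp
  have bij: "bij_betw (blinfun_apply (transition A m n)) (ker (P n)) (ker (P m))" if "n \<le> m" "m \<le> 0" for n m
    using that
  proof (induction m rule: int_ge_induct)
    case base
    have "blinfun_apply (id_blinfun :: 'a \<Rightarrow>\<^sub>L 'a) = id" by auto
    then show ?case by simp
  next
    case (step m)
    have eq: "blinfun_apply (transition A (m + 1) n) = A m \<circ> transition A m n"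
      using step by (auto simp: transition_Suc)
    show ?case
      unfolding eq by (rule bij_betw_trans[of _ _ "ker (P m)"]) (use step A[of m] in auto)
  qed
  have idem: "P m (P m x) = P m x" if "m \<le> 0" for m x
    using P[OF that] by (metis blinfun_apply_blinfun_compose)
  have "dichotomy_data A P K \<alpha>"
    unfolding dichotomy_data_def
  proof (intro allI impI, elim conjE, intro conjI impI)
    fix n m :: int and x assume nm: "n \<le> m" "m \<le> 0"
    note b = bij[OF nm]
    show "P m (P m x) = P m x" by (rule idem[OF nm(2)])
    show "transition A m n (P n x) = P m (transition A m n x)" by (rule comm[OF nm])
    have "norm ((transition A m n o\<^sub>L P n) x) \<le> K * exp (- \<alpha> * real_of_int (m - n)) * norm x"
      by (rule order_trans[OF norm_blinfun mult_right_mono[OF fw[OF nm] norm_ge_zero]])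
    then show "norm (transition A m n (P n x)) \<le> K * exp (- \<alpha> * real_of_int (m - n)) * norm x"
      by simp
    show "x = 0" if "P n x = 0" "transition A m n x = 0"
      using inj_onD[OF bij_betw_imp_inj_on[OF b], of x 0] that by (simp add: ker_def)
    \<comment> \<open>Being in the image of \<open>ker (P n)\<close>, this vector has a genuine
      preimage there, namely the value of \<open>inv_into\<close>.\<close>
    have "x - P m x \<in> ker (P m)" by (simp add: ker_def blinfun.diff_right idem nm)
    then have *: "x - P m x \<in> transition A m n ` ker (P n)" using b by (simp add: bij_betw_def)
    show "\<exists>y. P n y = 0 \<and> transition A m n y = x - P m x \<and>
             norm y \<le> K * exp (- \<alpha> * real_of_int (m - n)) * norm x"
      using inv_into_into[OF *] f_inv_into_f[OF *] bw[OF nm, of x] by (auto simp: ker_def)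
  qed
  moreover have "P n (s c x) = s c (P n x)" if "n \<le> 0" for n c x
    using P[OF that] by (simp add: Vector_Spaces.linear_iff)
  ultimately show thesis using that K by blast
qed

text \<open>With invertible coefficients the backward evolution maps kernels to kernels, so it is
  the inverse that \<open>inv_into\<close> selects.\<close>

lemma exp_dichotomy_of_splitting:
  fixes A :: "int \<Rightarrow> 'a::banach \<Rightarrow>\<^sub>L 'a" and s :: "'k::real_normed_field \<Rightarrow> 'a \<Rightarrow> 'a"
  assumes s: "normed_scaling s"
    and A: "\<And>n. n \<le> 0 \<Longrightarrow> invertible_blinfun (A n)"
    and Q: "invariant_splitting s (evolution A) Q"
    and green: "green_bounds (evolution A) Q K \<alpha>" and K: "0 < K" "0 < \<alpha>"
  shows "exp_dichotomy s A"
  unfolding exp_dichotomy_def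
proof (rule exI[of _ Q], rule exI[of _ K], rule exI[of _ \<alpha>], intro conjI allI impI)
  have "cocycle (evolution A)" using A by (rule cocycle_evolution)
  note coc = cocycleD[OF this]
  have forward: "evolution A m n = transition A m n" if "n \<le> m" "m \<le> 0" for n m
    using A that by (rule evolution_forward)
  have idem: "Q n (Q n x) = Q n x" if "n \<le> 0" for n x
    using Q that unfolding invariant_splitting_def by (metis blinfun_apply_blinfun_compose)
  have comm: "evolution A m n (Q n x) = Q m (evolution A m n x)" if "n \<le> 0" "m \<le> 0" for n m x
    using Q that unfolding invariant_splitting_def by (metis blinfun_apply_blinfun_compose)
  fix n :: int
  { assume "n \<le> 0"
    then show "Q n o\<^sub>L Q n = Q n" "Vector_Spaces.linear s s (blinfun_apply (Q n))"
      using Q by (auto simp: invariant_splitting_def linear_blinfun_iff[OF s s]) }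
  { assume n: "n < 0"
    have An: "A n = evolution A (n + 1) n"
      using n transition_Suc[of n n A] forward[of n "n + 1"]
      by (auto intro!: blinfun_eqI)
    show "A n o\<^sub>L Q n = Q (n + 1) o\<^sub>L A n"
      using n by (auto intro!: blinfun_eqI simp: An comm)
    show "bij_betw (blinfun_apply (A n)) (ker (Q n)) (ker (Q (n + 1)))"
      by (rule bij_betw_byWitness[where f' = "evolution A n (n + 1)"])
        (use n in \<open>auto simp: An coc ker_def simp flip: comm\<close>) }
  { fix m :: int assume "n \<le> m \<and> m \<le> 0"
    then show "norm (transition A m n o\<^sub>L Q n) \<le> K * exp (- \<alpha> * real_of_int (m - n))"
      using green by (simp add: green_bounds_def flip: forward) }
  { fix m :: int and x assume nm: "n \<le> m \<and> m \<le> 0"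
    let ?y = "evolution A n m (x - Q m x)"
    have "inv_into (ker (Q n)) (blinfun_apply (transition A m n)) (x - Q m x) = ?y"
    proof (rule inv_into_f_eq)
      show "inj_on (blinfun_apply (transition A m n)) (ker (Q n))"
        by (rule inj_on_inverseI[of _ "evolution A n m"])
          (use nm in \<open>simp add: coc flip: forward\<close>)
      show "?y \<in> ker (Q n)"
        using nm by (simp add: ker_def comm[symmetric] blinfun.diff_right idem)
      show "transition A m n ?y = x - Q m x"
        using nm by (simp add: coc flip: forward)
    qed
    then show "norm (inv_into (ker (Q n)) (blinfun_apply (transition A m n)) (x - Q m x))
        \<le> K * exp (- \<alpha> * real_of_int (m - n)) * norm x"
      using green_boundsD(2)[OF green, of n m x] nm by simp }
qed (use K in auto)

text \<open>Transposing a second time returns to \<Phi>, but adjoints put the projection behind the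
  evolution and exchange forward with backward bounds. Commutation repairs the order, and
  \<open>id_blinfun - Q n\<close> in place of \<open>Q n\<close> repairs the direction.\<close>

lemma adj_splitting:
  fixes \<Phi> :: "int \<Rightarrow> int \<Rightarrow> 'a::{real_inner,banach} \<Rightarrow>\<^sub>L 'a" and s :: "'k::real_normed_field \<Rightarrow> 'a \<Rightarrow> 'a"
  assumes s: "normed_scaling s"
    and Q: "invariant_splitting s (\<lambda>m n. adj (\<Phi> n m)) Q"
    and green: "green_bounds (\<lambda>m n. adj (\<Phi> n m)) Q K \<alpha>"
  shows "invariant_splitting s \<Phi> (\<lambda>n. adj (id_blinfun - Q n))"
    and "green_bounds \<Phi> (\<lambda>n. adj (id_blinfun - Q n)) K \<alpha>"
proof -
  have comm: "Q m o\<^sub>L adj (\<Phi> n m) = adj (\<Phi> n m) o\<^sub>L Q n" if "m \<le> 0" "n \<le> 0" for m n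
    using Q that by (simp add: invariant_splitting_def)
  have comm': "\<Phi> n m o\<^sub>L adj (Q m) = adj (Q n) o\<^sub>L \<Phi> n m" if "m \<le> 0" "n \<le> 0" for m n
    using arg_cong[OF comm[OF that], of adj] by (simp add: adj_compose)
  show "invariant_splitting s \<Phi> (\<lambda>n. adj (id_blinfun - Q n))"
    unfolding invariant_splitting_def
  proof (intro conjI allI impI)
    fix n :: int assume n: "n \<le> 0"
    have "adj (Q n) o\<^sub>L adj (Q n) = adj (Q n)"
      using Q n by (simp add: invariant_splitting_def flip: adj_compose)
    then show "adj (id_blinfun - Q n) o\<^sub>L adj (id_blinfun - Q n) = adj (id_blinfun - Q n)"
      by (simp add: adj_diff blinfun_eq_iff blinfun.diff_left blinfun.diff_right)
    show "adj (id_blinfun - Q n) (s c x) = s c (adj (id_blinfun - Q n) x)" for c x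
      by (rule adj_scaling[OF s s])
        (use Q n in \<open>simp add: invariant_splitting_def blinfun.diff_left normed_scaling_simps[OF s]\<close>)
  next
    fix m n :: int assume "m \<le> 0" "n \<le> 0"
    then show "\<Phi> m n o\<^sub>L adj (id_blinfun - Q n) = adj (id_blinfun - Q m) o\<^sub>L \<Phi> m n"
      using comm'[of n m] by (simp add: adj_diff blinfun_eq_iff blinfun.diff_left blinfun.diff_right)
  qed
  show "green_bounds \<Phi> (\<lambda>n. adj (id_blinfun - Q n)) K \<alpha>"
    unfolding green_bounds_def
  proof (intro allI impI, elim conjE, intro conjI)
    fix n m :: int assume nm: "n \<le> m" "m \<le> 0"
    have "\<Phi> m n o\<^sub>L adj (id_blinfun - Q n) = adj (adj (\<Phi> m n) o\<^sub>L (id_blinfun - Q m))"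
      using comm'[of n m] nm by (simp add: adj_compose adj_diff blinfun_eq_iff blinfun.diff_left blinfun.diff_right)
    moreover have "norm (adj (\<Phi> m n) o\<^sub>L (id_blinfun - Q m)) \<le> K * exp (- \<alpha> * real_of_int (m - n))"
      using green nm by (simp add: green_bounds_def)
    ultimately show "norm (\<Phi> m n o\<^sub>L adj (id_blinfun - Q n)) \<le> K * exp (- \<alpha> * real_of_int (m - n))"
      using norm_adj_le order_trans by metis
    have "\<Phi> n m o\<^sub>L (id_blinfun - adj (id_blinfun - Q m)) = adj (adj (\<Phi> n m) o\<^sub>L Q n)"
      using comm'[of m n] nm by (simp add: adj_compose adj_diff)
    moreover have "norm (adj (\<Phi> n m) o\<^sub>L Q n) \<le> K * exp (- \<alpha> * real_of_int (m - n))"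
      using green nm by (simp add: green_bounds_def)
    ultimately show "norm (\<Phi> n m o\<^sub>L (id_blinfun - adj (id_blinfun - Q m))) \<le> K * exp (- \<alpha> * real_of_int (m - n))"
      using norm_adj_le order_trans by metis
  qed
qed

section \<open>Block systems\<close>

text \<open>The second coordinate of a triangular system evolves on its own; dually the first factor
  is invariant, as the next lemma records. This asymmetry decides how each block is treated
  below.\<close>

lemma snd_transition_block:
  assumes "n \<le> m" "m \<le> 0"
  shows "snd (transition (\<lambda>k. block_upper (A k) (B k) (D k)) m n v) = transition D m n (snd v)"
  by (rule transition_intertwine[OF assms]) (auto simp: block_upper_apply)

lemma transition_block_fst:
  assumes "n \<le> m" "m \<le> 0"
  shows "transition (\<lambda>k. block_upper (A k) (B k) (D k)) m n (x, 0) = (transition A m n x, 0)"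
  by (rule transition_intertwine[OF assms, where f = "\<lambda>x. (x, 0)", symmetric]) (simp add: blinfun.zero_right)

lemma fst_transition_block_diag:
  assumes "n \<le> m" "m \<le> 0"
  shows "fst (transition (\<lambda>k. block_upper (A k) 0 (D k)) m n v) = transition A m n (fst v)"
  by (rule transition_intertwine[OF assms]) auto

lemma transition_block_diag:
  assumes "n \<le> m" "m \<le> 0"
  shows "transition (\<lambda>k. block_upper (A k) 0 (D k)) m n (x, y) = (transition A m n x, transition D m n y)"
  using fst_transition_block_diag[OF assms, of A D "(x, y)"] snd_transition_block[OF assms, of A "\<lambda>_. 0" D "(x, y)"]
  by (simp add: prod_eq_iff)

section \<open>Green bounds for the two diagonal blocks\<close>

lemma norm_fst_le_norm: "norm (fst v) \<le> norm v"
  and norm_snd_le_norm: "norm (snd v) \<le> norm v"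
  by (cases v; simp add: norm_fst_le norm_snd_le)+

text \<open>The second coordinate map intertwines the evolutions, so both bounds of the triangular
  system can be read off in that coordinate, starting from vectors \<open>(0, y)\<close>.\<close>

lemma green_bounds_22:
  fixes A :: "int \<Rightarrow> 'a::real_normed_vector \<Rightarrow>\<^sub>L 'a" and D :: "int \<Rightarrow> 'b::real_normed_vector \<Rightarrow>\<^sub>L 'b"
  assumes data: "dichotomy_data (\<lambda>n. block_upper (A n) (B n) (D n)) P K \<alpha>" and K: "0 < K"
    and D: "\<And>n. n \<le> 0 \<Longrightarrow> invertible_blinfun (D n)"
  shows "green_bounds (evolution D) (\<lambda>n. Blinfun (\<lambda>y. snd (P n (0, y)))) K \<alpha>"
proof -
  let ?T = "transition (\<lambda>n. block_upper (A n) (B n) (D n))"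
  have p: "blinfun_apply (Blinfun (\<lambda>y. snd (P n (0, y)))) = (\<lambda>y. snd (P n (0, y)))" for n
    by (rule bounded_linear_Blinfun_apply[OF bounded_linear_compose[OF bounded_linear_snd
          bounded_linear_compose[OF blinfun.bounded_linear_right
            bounded_linear_Pair[OF bounded_linear_zero bounded_linear_ident]]]])
  have forward: "evolution D m n = transition D m n" if "n \<le> m" "m \<le> 0" for n m
    using D that by (rule evolution_forward)
  have "cocycle (evolution D)" using D by (rule cocycle_evolution)
  note coc = cocycleD[OF this]
  show ?thesis
  proof (rule green_boundsI)
    fix n m :: int and y assume nm: "n \<le> m" "m \<le> 0"
    note dat = dichotomy_dataD[OF data nm, of "(0, y)"]
    have "norm (transition D m n (snd (P n (0, y)))) \<le> norm (?T m n (P n (0, y)))"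
      by (subst snd_transition_block[OF nm, symmetric]) (rule norm_snd_le_norm)
    then show "norm (evolution D m n (Blinfun (\<lambda>y. snd (P n (0, y))) y))
        \<le> K * exp (- \<alpha> * real_of_int (m - n)) * norm y"
      using dat(3) by (simp add: p forward nm)
    \<comment> \<open>\<open>z\<close> is the backward image of \<open>(0, y) - P m (0, y)\<close>;
      its second coordinate must be the backward image under \<open>D\<close>.\<close>
    obtain z where z: "?T m n z = (0, y) - P m (0, y)"
        "norm z \<le> K * exp (- \<alpha> * real_of_int (m - n)) * norm (0::'a, y)"
      using dat(5) by blast
    have "transition D m n (snd z) = y - snd (P m (0, y))"
      using snd_transition_block[OF nm, of A B D z] z(1) by simp
    moreover have "evolution D n m (transition D m n (snd z)) = snd z"
      using nm by (simp add: coc flip: forward)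
    ultimately have "evolution D n m (y - snd (P m (0, y))) = snd z" by simp
    moreover have "norm (snd z) \<le> norm z" by (rule norm_snd_le_norm)
    ultimately show "norm (evolution D n m (y - Blinfun (\<lambda>y. snd (P m (0, y))) y))
        \<le> K * exp (- \<alpha> * real_of_int (m - n)) * norm y"
      using z(2) by (simp add: p)
  qed (use K in simp)
qed

text \<open>Only the embedding of the first factor intertwines, not the projection to it. Hence the
  corner can be estimated after the evolution but not before it, and taking adjoints turns this into
  Green bounds for the transposed evolution.\<close>

lemma green_bounds_11_adj:
  fixes A :: "int \<Rightarrow> 'a::{real_inner,banach} \<Rightarrow>\<^sub>L 'a" and D :: "int \<Rightarrow> 'b::real_normed_vector \<Rightarrow>\<^sub>L 'b"
  assumes data: "dichotomy_data (\<lambda>n. block_upper (A n) (B n) (D n)) P K \<alpha>" and K: "0 < K"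
    and A: "\<And>n. n \<le> 0 \<Longrightarrow> invertible_blinfun (A n)"
  shows "green_bounds (\<lambda>m n. adj (evolution A n m))
    (\<lambda>n. adj (id_blinfun - Blinfun (\<lambda>x. fst (P n (x, 0))))) K \<alpha>"
proof -
  let ?T = "transition (\<lambda>n. block_upper (A n) (B n) (D n))"
  define p where "p n = Blinfun (\<lambda>x. fst (P n (x, 0)))" for n
  have p: "p n x = fst (P n (x, 0))" for n x
    unfolding p_def
    by (subst bounded_linear_Blinfun_apply[OF bounded_linear_compose[OF bounded_linear_fst
          bounded_linear_compose[OF blinfun.bounded_linear_right
            bounded_linear_Pair[OF bounded_linear_ident bounded_linear_zero]]]]) (rule refl)
  have forward: "evolution A m n = transition A m n" if "n \<le> m" "m \<le> 0" for n m
    using A that by (rule evolution_forward)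
  have "cocycle (evolution A)" using A by (rule cocycle_evolution)
  note coc = cocycleD[OF this]
  have 1: "norm ((id_blinfun - p n) o\<^sub>L evolution A n m) \<le> K * exp (- \<alpha> * real_of_int (m - n))"
    if nm: "n \<le> m" "m \<le> 0" for n m
  proof (rule norm_blinfun_bound)
    fix x
    define x' where "x' = evolution A n m x"
    have x: "x = transition A m n x'" unfolding x'_def using nm by (simp add: coc flip: forward)
    obtain y where y: "P n y = 0" "?T m n y = (x, 0) - P m (x, 0)"
        "norm y \<le> K * exp (- \<alpha> * real_of_int (m - n)) * norm (x, 0::'b)"
      using dichotomy_dataD(5)[OF data nm, of "(x, 0)"] by blast
    have idem: "P n (P n v) = P n v" for v
      using dichotomy_dataD(1)[OF data, of n n] nm by simp
    have Tx: "?T m n (x', 0) = (x, 0)"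
      by (simp add: x transition_block_fst[OF nm])
    \<comment> \<open>Both vectors lie in the kernel of \<open>P n\<close> and have the same image
      at time \<open>m\<close>, so injectivity on the kernel identifies them.\<close>
    have "y - ((x', 0) - P n (x', 0)) = 0"
    proof (rule dichotomy_dataD(4)[OF data nm])
      show "P n (y - ((x', 0) - P n (x', 0))) = 0"
        by (simp only: blinfun.diff_right y(1) idem) simp
      show "?T m n (y - ((x', 0) - P n (x', 0))) = 0"
        by (simp only: blinfun.diff_right y(2) dichotomy_dataD(2)[OF data nm] Tx) simp
    qed
    then have "fst y = x' - p n x'" by (simp add: p)
    moreover have "norm (fst y) \<le> norm y" by (rule norm_fst_le_norm)
    ultimately show "norm (((id_blinfun - p n) o\<^sub>L evolution A n m) x) \<le> K * exp (- \<alpha> * real_of_int (m - n)) * norm x"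
      using y(3) by (simp add: blinfun.diff_left x'_def)
  qed (use K in simp)
  have 2: "norm (p m o\<^sub>L evolution A m n) \<le> K * exp (- \<alpha> * real_of_int (m - n))"
    if nm: "n \<le> m" "m \<le> 0" for n m
  proof (rule norm_blinfun_bound)
    fix x
    have "P m (transition A m n x, 0) = ?T m n (P n (x, 0))"
      by (simp add: dichotomy_dataD(2)[OF data nm] transition_block_fst[OF nm])
    moreover have "norm (fst (P m (transition A m n x, 0))) \<le> norm (P m (transition A m n x, 0))"
      by (rule norm_fst_le_norm)
    ultimately show "norm ((p m o\<^sub>L evolution A m n) x) \<le> K * exp (- \<alpha> * real_of_int (m - n)) * norm x"
      using dichotomy_dataD(3)[OF data nm, of "(x, 0)"] nm by (simp add: p forward)
  qed (use K in simp)
  show ?thesis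
    unfolding green_bounds_def p_def[symmetric]
  proof (intro allI impI, elim conjE, intro conjI)
    fix n m :: int assume nm: "n \<le> m" "m \<le> 0"
    have "adj (evolution A n m) o\<^sub>L adj (id_blinfun - p n) = adj ((id_blinfun - p n) o\<^sub>L evolution A n m)"
      by (simp add: adj_compose)
    then show "norm (adj (evolution A n m) o\<^sub>L adj (id_blinfun - p n)) \<le> K * exp (- \<alpha> * real_of_int (m - n))"
      using order_trans[OF norm_adj_le 1[OF nm]] by simp
    have "adj (evolution A m n) o\<^sub>L (id_blinfun - adj (id_blinfun - p m)) = adj (p m o\<^sub>L evolution A m n)"
      by (simp add: adj_compose adj_diff)
    then show "norm (adj (evolution A m n) o\<^sub>L (id_blinfun - adj (id_blinfun - p m))) \<le> K * exp (- \<alpha> * real_of_int (m - n))"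
      using order_trans[OF norm_adj_le 2[OF nm]] by simp
  qed
qed

text \<open>The direct sum of two splittings with a common rate; the constants add up because the
  norm of a pair is at most the sum of the norms.\<close>

lemma exp_dichotomy_block_diag:
  fixes A :: "int \<Rightarrow> 'a::banach \<Rightarrow>\<^sub>L 'a" and D :: "int \<Rightarrow> 'b::banach \<Rightarrow>\<^sub>L 'b"
    and s1 :: "'k::real_normed_field \<Rightarrow> 'a \<Rightarrow> 'a" and s2 :: "'k \<Rightarrow> 'b \<Rightarrow> 'b"
  assumes s: "normed_scaling s1" "normed_scaling s2"
    and A: "\<And>n. n \<le> 0 \<Longrightarrow> invertible_blinfun (A n)" and D: "\<And>n. n \<le> 0 \<Longrightarrow> invertible_blinfun (D n)"
    and Q1: "invariant_splitting s1 (evolution A) Q1" "green_bounds (evolution A) Q1 K1 \<alpha>" "0 < K1"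
    and Q2: "invariant_splitting s2 (evolution D) Q2" "green_bounds (evolution D) Q2 K2 \<alpha>" "0 < K2"
    and \<alpha>: "0 < \<alpha>"
  shows "exp_dichotomy (module_prod.scale s1 s2) (\<lambda>n. block_upper (A n) 0 (D n))"
proof (rule exp_dichotomy_of_splitting)
  let ?B = "\<lambda>n. block_upper (A n) 0 (D n)" and ?Q = "\<lambda>n. block_upper (Q1 n) 0 (Q2 n)"
  show inv: "invertible_blinfun (?B n)" if "n \<le> 0" for n
    by (rule invertible_blinfunI[of "block_upper (blinfun_inv (A n)) 0 (blinfun_inv (D n))"])
      (auto simp: blinfun_inv A D that)
  have ev: "evolution ?B m n (x, y) = (evolution A m n x, evolution D m n y)" if mn: "m \<le> 0" "n \<le> 0" for m n x y
  proof -
    \<comment> \<open>The evolution is identified by comparing both sides at time 0 and cancelling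
      the transition from \<open>m\<close> to 0.\<close>
    have "transition ?B 0 m (evolution A m n x, evolution D m n y) = transition ?B 0 n (x, y)"
      using mn by (simp add: transition_block_diag evolution_def blinfun_inv invertible_transition A D)
    moreover have "invertible_blinfun (transition ?B 0 m)"
      using mn(1) order.refl inv by (rule invertible_transition)
    note blinfun_inv(1)[OF this, of "(evolution A m n x, evolution D m n y)"]
    ultimately have "blinfun_inv (transition ?B 0 m) (transition ?B 0 n (x, y)) = (evolution A m n x, evolution D m n y)"
      by simp
    then show ?thesis by (simp add: evolution_def)
  qed
  show "normed_scaling (module_prod.scale s1 s2)" by (rule normed_scaling_prod[OF s])
  have Q1': "Q1 n (Q1 n x) = Q1 n x" "Q1 n (s1 c x) = s1 c (Q1 n x)" if "n \<le> 0" for n x c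
    using Q1(1) that unfolding invariant_splitting_def by (metis blinfun_apply_blinfun_compose)+
  have Q2': "Q2 n (Q2 n x) = Q2 n x" "Q2 n (s2 c x) = s2 c (Q2 n x)" if "n \<le> 0" for n x c
    using Q2(1) that unfolding invariant_splitting_def by (metis blinfun_apply_blinfun_compose)+
  have Q1c: "evolution A m n (Q1 n x) = Q1 m (evolution A m n x)" if "m \<le> 0" "n \<le> 0" for m n x
    using Q1(1) that unfolding invariant_splitting_def by (metis blinfun_apply_blinfun_compose)
  have Q2c: "evolution D m n (Q2 n x) = Q2 m (evolution D m n x)" if "m \<le> 0" "n \<le> 0" for m n x
    using Q2(1) that unfolding invariant_splitting_def by (metis blinfun_apply_blinfun_compose)
  show "invariant_splitting (module_prod.scale s1 s2) (evolution ?B) ?Q"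
    unfolding invariant_splitting_def
    by (auto intro!: blinfun_eqI simp: ev Q1' Q2' Q1c Q2c normed_scaling_prod(2)[OF s])
  have est: "norm (x', y') \<le> (K1 + K2) * e * norm (x, y)"
    if "norm x' \<le> K1 * e * norm x" "norm y' \<le> K2 * e * norm y" "0 \<le> e"
    for x x' :: 'a and y y' :: 'b and e :: real
  proof -
    have "norm (x', y') \<le> norm x' + norm y'" by (rule norm_Pair_le)
    also have "\<dots> \<le> K1 * e * norm (x, y) + K2 * e * norm (x, y)"
      using that Q1(3) Q2(3)
      by (intro add_mono; elim order_trans; intro mult_left_mono norm_fst_le norm_snd_le) auto
    finally show ?thesis by (simp add: algebra_simps)
  qed
  show "green_bounds (evolution ?B) ?Q (K1 + K2) \<alpha>"
  proof (rule green_boundsI)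
    fix n m :: int and v :: "'a \<times> 'b" assume nm: "n \<le> m" "m \<le> 0"
    obtain x y where v: "v = (x, y)" by fastforce
    show "norm (evolution ?B m n (?Q n v)) \<le> (K1 + K2) * exp (- \<alpha> * real_of_int (m - n)) * norm v"
      using est[OF green_boundsD(1)[OF Q1(2) nm] green_boundsD(1)[OF Q2(2) nm]] nm by (simp add: v ev)
    show "norm (evolution ?B n m (v - ?Q m v)) \<le> (K1 + K2) * exp (- \<alpha> * real_of_int (m - n)) * norm v"
      using est[OF green_boundsD(2)[OF Q1(2) nm] green_boundsD(2)[OF Q2(2) nm]] nm by (simp add: v ev)
  qed (use Q1 Q2 in simp)
  show "0 < K1 + K2" "0 < \<alpha>" using Q1 Q2 \<alpha> by auto
qed

section \<open>Kernels and bounded orbits of a diagonal system\<close>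

lemma nonpos_of_exp_decay:
  fixes x :: real
  assumes "0 < \<alpha>" "\<And>n. n \<le> (0::int) \<Longrightarrow> x \<le> M * exp (\<alpha> * n)"
  shows "x \<le> 0"
proof (rule LIMSEQ_le_const)
  have "(\<lambda>n. M * exp (- \<alpha>) ^ n) \<longlonglongrightarrow> M * 0"
    using assms(1) by (intro tendsto_intros LIMSEQ_power_zero) simp
  then show "(\<lambda>n. M * exp (- \<alpha>) ^ n) \<longlonglongrightarrow> 0" by simp
  have "x \<le> M * exp (- \<alpha>) ^ n" for n
    using assms(2)[of "- int n"] by (simp add: exp_of_nat_mult[symmetric] mult.commute)
  then show "\<exists>N. \<forall>n\<ge>N. x \<le> M * exp (- \<alpha>) ^ n" by blast
qed

text \<open>Describes the kernel of \<open>P 0\<close> without mentioning \<open>P\<close>. Kernel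
  vectors have small preimages by the backward bound; conversely \<open>P 0 w\<close> is the image
  of \<open>P n y\<close>, which tends to 0 along bounded preimages \<open>y\<close> as
  \<open>n\<close> tends to minus infinity.\<close>

lemma dichotomy_kernel_iff:
  assumes data: "dichotomy_data A P K \<alpha>" and K: "0 < K" "0 < \<alpha>"
  shows "P 0 w = 0 \<longleftrightarrow> (\<exists>C. \<forall>n\<le>0. \<exists>y. transition A 0 n y = w \<and> norm y \<le> C)"
proof (rule iffI, rule exI[of _ "K * 1 * norm w"], intro allI impI)
  fix n :: int assume w: "P 0 w = 0" and n: "n \<le> 0"
  obtain y where y: "transition A 0 n y = w"
      "norm y \<le> K * exp (- \<alpha> * real_of_int (0 - n)) * norm w"
    using dichotomy_dataD(5)[OF data n order.refl, of w] w by auto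
  have "K * exp (- \<alpha> * real_of_int (0 - n)) * norm w \<le> K * 1 * norm w"
    using K n by (intro mult_right_mono mult_left_mono) (auto simp: mult_le_0_iff)
  with y show "\<exists>y. transition A 0 n y = w \<and> norm y \<le> K * 1 * norm w" by auto
next
  assume "\<exists>C. \<forall>n\<le>0. \<exists>y. transition A 0 n y = w \<and> norm y \<le> C"
  then obtain C where C: "\<And>n. n \<le> 0 \<Longrightarrow> \<exists>y. transition A 0 n y = w \<and> norm y \<le> C" by blast
  have "norm (P 0 w) \<le> 0"
  proof (rule nonpos_of_exp_decay[OF K(2)])
    fix n :: int assume n: "n \<le> 0"
    then obtain y where y: "transition A 0 n y = w" "norm y \<le> C" using C by blast
    have "norm (P 0 w) \<le> K * exp (\<alpha> * n) * norm y"
      using dichotomy_dataD(2,3)[OF data n order.refl, of y] y(1) by simp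
    also have "\<dots> \<le> K * exp (\<alpha> * n) * C"
      using y(2) K by (intro mult_left_mono) auto
    finally show "norm (P 0 w) \<le> K * C * exp (\<alpha> * n)" by (simp add: mult_ac)
  qed
  then show "P 0 w = 0" by simp
qed

text \<open>\<open>P 0\<close> may have off-diagonal entries, but its kernel is still a product:
  bounded preimages under a diagonal system can be taken coordinatewise.\<close>

lemma kernel_block_diag:
  fixes A :: "int \<Rightarrow> 'a::real_normed_vector \<Rightarrow>\<^sub>L 'a" and D :: "int \<Rightarrow> 'b::real_normed_vector \<Rightarrow>\<^sub>L 'b"
  assumes data: "dichotomy_data (\<lambda>n. block_upper (A n) 0 (D n)) P K \<alpha>" and K: "0 < K" "0 < \<alpha>"
    and w: "P 0 (u, v) = 0"
  shows "P 0 (u, 0) = 0" "P 0 (0, v) = 0"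
proof -
  obtain C where C: "\<And>n. n \<le> 0 \<Longrightarrow>
      \<exists>y. transition (\<lambda>n. block_upper (A n) 0 (D n)) 0 n y = (u, v) \<and> norm y \<le> C"
    using w unfolding dichotomy_kernel_iff[OF data K] by blast
  have *: "\<exists>x y. transition A 0 n x = u \<and> transition D 0 n y = v \<and> norm x \<le> C \<and> norm y \<le> C" if n: "n \<le> 0" for n
  proof -
    obtain x y where "transition (\<lambda>n. block_upper (A n) 0 (D n)) 0 n (x, y) = (u, v)" "norm (x, y) \<le> C"
      using C[OF n] by auto
    then show ?thesis
      using norm_fst_le[of x y] norm_snd_le[of y x]
      by (intro exI[of _ x] exI[of _ y]) (simp add: transition_block_diag[OF n])
  qed
  show "P 0 (u, 0) = 0"
    unfolding dichotomy_kernel_iff[OF data K]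
  proof (rule exI[of _ C], intro allI impI)
    fix n :: int assume n: "n \<le> 0"
    then obtain x where "transition A 0 n x = u" "norm x \<le> C" using * by blast
    then show "\<exists>y. transition (\<lambda>n. block_upper (A n) 0 (D n)) 0 n y = (u, 0) \<and> norm y \<le> C"
      by (intro exI[of _ "(x, 0)"]) (simp add: transition_block_diag[OF n] norm_Pair)
  qed
  show "P 0 (0, v) = 0"
    unfolding dichotomy_kernel_iff[OF data K]
  proof (rule exI[of _ C], intro allI impI)
    fix n :: int assume n: "n \<le> 0"
    then obtain y where "transition D 0 n y = v" "norm y \<le> C" using * by blast
    then show "\<exists>y. transition (\<lambda>n. block_upper (A n) 0 (D n)) 0 n y = (0, v) \<and> norm y \<le> C"
      by (intro exI[of _ "(0, y)"]) (simp add: transition_block_diag[OF n] norm_Pair)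
  qed
qed

text \<open>The kernel criterion for vectors \<open>(0, v)\<close>: invertibility forces the second
  coordinate of a preimage to be \<open>evolution D n 0 v\<close>, and 0 serves as the
  first.\<close>

lemma bounded_orbits_22:
  fixes A :: "int \<Rightarrow> 'a::real_normed_vector \<Rightarrow>\<^sub>L 'a" and D :: "int \<Rightarrow> 'b::real_normed_vector \<Rightarrow>\<^sub>L 'b"
  assumes data: "dichotomy_data (\<lambda>n. block_upper (A n) 0 (D n)) P K \<alpha>" and K: "0 < K" "0 < \<alpha>"
    and D: "\<And>n. n \<le> 0 \<Longrightarrow> invertible_blinfun (D n)"
  shows "{v. bdd_above ((\<lambda>n. norm (evolution D n 0 v)) ` {..0})} = {v. P 0 (0, v) = 0}"
proof -
  have forward: "evolution D m n = transition D m n" if "n \<le> m" "m \<le> 0" for n m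
    using D that by (rule evolution_forward)
  have "cocycle (evolution D)" using D by (rule cocycle_evolution)
  note coc = cocycleD[OF this]
  have "bdd_above ((\<lambda>n. norm (evolution D n 0 v)) ` {..0}) \<longleftrightarrow>
      (\<exists>C. \<forall>n\<le>0. \<exists>y. transition (\<lambda>n. block_upper (A n) 0 (D n)) 0 n y = (0, v) \<and> norm y \<le> C)" for v
    unfolding bdd_above_def
  proof (intro ex_cong1 iffI allI impI ballI)
    fix C and n :: int
    assume C: "\<forall>x\<in>(\<lambda>n. norm (evolution D n 0 v)) ` {..0}. x \<le> C" and n: "n \<le> 0"
    then show "\<exists>y. transition (\<lambda>n. block_upper (A n) 0 (D n)) 0 n y = (0, v) \<and> norm y \<le> C"
      by (intro exI[of _ "(0, evolution D n 0 v)"])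
        (auto simp: transition_block_diag coc blinfun.zero_right simp flip: forward)
  next
    fix C x
    assume C: "\<forall>n\<le>0. \<exists>y. transition (\<lambda>n. block_upper (A n) 0 (D n)) 0 n y = (0, v) \<and> norm y \<le> C"
      and "x \<in> (\<lambda>n. norm (evolution D n 0 v)) ` {..0}"
    then obtain n where n: "n \<le> 0" and x: "x = norm (evolution D n 0 v)" by auto
    obtain y z where yz: "transition (\<lambda>n. block_upper (A n) 0 (D n)) 0 n (y, z) = (0, v)" "norm (y, z) \<le> C"
      using C n by fastforce
    then have "evolution D n 0 v = z"
      using n by (auto simp: transition_block_diag coc simp flip: forward)
    then show "x \<le> C" using yz(2) norm_snd_le[of z y] x by simp
  qed
  then show ?thesis unfolding dichotomy_kernel_iff[OF data K] by simp
qed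

text \<open>Duality. If \<open>u\<close> is in the kernel, pairing its decaying preimages with a
  bounded adjoint orbit of \<open>v\<close> gives \<open>u \<bullet> v = 0\<close>. Conversely, for
  \<open>v\<close> orthogonal to the kernel only the component in the range of \<open>P 0\<close> is
  seen by \<open>v\<close>, and the forward bound applies to it.\<close>

lemma bounded_adjoint_orbits_11:
  fixes A :: "int \<Rightarrow> 'a::{real_inner,banach} \<Rightarrow>\<^sub>L 'a" and D :: "int \<Rightarrow> 'b::real_normed_vector \<Rightarrow>\<^sub>L 'b"
  assumes data: "dichotomy_data (\<lambda>n. block_upper (A n) 0 (D n)) P K \<alpha>" and K: "0 < K" "0 < \<alpha>"
    and A: "\<And>n. n \<le> 0 \<Longrightarrow> invertible_blinfun (A n)"
  shows "{v. bdd_above ((\<lambda>n. norm (adj (evolution A 0 n) v)) ` {..0})} = {u. P 0 (u, 0) = 0}\<^sup>\<bottom>"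
proof -
  let ?T = "transition (\<lambda>n. block_upper (A n) 0 (D n))"
  have forward: "evolution A m n = transition A m n" if "n \<le> m" "m \<le> 0" for n m
    using A that by (rule evolution_forward)
  have "u \<bullet> v = 0"
    if bdd: "bdd_above ((\<lambda>n. norm (adj (evolution A 0 n) v)) ` {..0})" and u: "P 0 (u, 0) = 0" for u v
  proof -
    obtain C where C: "\<And>n. n \<le> 0 \<Longrightarrow> norm (adj (evolution A 0 n) v) \<le> C"
      using bdd unfolding bdd_above_def by (simp add: ball_simps) blast
    have "\<bar>u \<bullet> v\<bar> \<le> 0"
    proof (rule nonpos_of_exp_decay[OF K(2)])
      fix n :: int assume n: "n \<le> 0"
      obtain y z where yz: "?T 0 n (y, z) = (u, 0)" "norm (y, z) \<le> K * exp (- \<alpha> * real_of_int (0 - n)) * norm (u, 0::'b)"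
        using dichotomy_dataD(5)[OF data n order.refl, of "(u, 0)"] u by auto
      then have "u = evolution A 0 n y"
        using n by (simp add: transition_block_diag forward)
      then have "\<bar>u \<bullet> v\<bar> = \<bar>y \<bullet> adj (evolution A 0 n) v\<bar>" by (simp only: adj_inner)
      also have "\<dots> \<le> norm y * norm (adj (evolution A 0 n) v)" by (rule Cauchy_Schwarz_ineq2)
      also have "\<dots> \<le> (K * exp (\<alpha> * n) * norm u) * C"
        using order_trans[OF norm_fst_le yz(2)] C[OF n] K by (intro mult_mono) auto
      finally show "\<bar>u \<bullet> v\<bar> \<le> K * norm u * C * exp (\<alpha> * n)" by (simp add: mult_ac)
    qed
    then show ?thesis by simp
  qed
  moreover have "bdd_above ((\<lambda>n. norm (adj (evolution A 0 n) v)) ` {..0})"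
    if orth: "\<And>u. P 0 (u, 0) = 0 \<Longrightarrow> u \<bullet> v = 0" for v
  proof (rule bdd_aboveI2)
    fix n :: int assume "n \<in> {..0}"
    then have n: "n \<le> 0" by simp
    \<comment> \<open>The adjoint orbit is tested against itself:
      \<open>norm z * norm z = x \<bullet> v\<close>, so it suffices to bound the right side by a
      multiple of \<open>norm z\<close>.\<close>
    define z where "z = adj (evolution A 0 n) v"
    define x where "x = transition A 0 n z"
    obtain a b where ab: "P 0 (x, 0) = (a, b)" by fastforce
    have T: "?T 0 n (z, 0) = (x, 0)" using n by (simp add: transition_block_diag x_def blinfun.zero_right)
    have "P 0 ((x, 0) - P 0 (x, 0)) = 0"
      using dichotomy_dataD(1)[OF data n order.refl, of "(x, 0)"] by (simp add: blinfun.diff_right)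
    \<comment> \<open>The kernel vector is \<open>(x - a, - b)\<close>; since the kernel is a
      product, its first coordinate alone lies in it.\<close>
    then have "P 0 (x - a, 0) = 0"
      unfolding ab by (intro kernel_block_diag(1)[OF data K, of _ "- b"]) simp
    from orth[OF this] have xa: "x \<bullet> v = a \<bullet> v" by (simp add: inner_diff_left)
    have "norm (P 0 (x, 0)) \<le> K * exp (- \<alpha> * real_of_int (0 - n)) * norm z"
      using dichotomy_dataD(2,3)[OF data n order.refl, of "(z, 0)"] T by simp
    also have "\<dots> \<le> K * 1 * norm z"
      using K n by (intro mult_right_mono mult_left_mono) (auto simp: mult_le_0_iff)
    finally have a: "norm a \<le> K * norm z" using norm_fst_le[of a b] ab by simp
    have "norm z * norm z = x \<bullet> v"
      unfolding x_def forward[OF n order.refl, symmetric] adj_inner z_def[symmetric]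
      by (simp add: norm_eq_sqrt_inner)
    also have "\<dots> \<le> norm a * norm v" unfolding xa by (rule norm_cauchy_schwarz)
    also have "\<dots> \<le> norm z * (K * norm v)"
      using mult_right_mono[OF a norm_ge_zero[of v]] by (simp add: mult_ac)
    finally show "norm (adj (evolution A 0 n) v) \<le> K * norm v"
      using K unfolding z_def[symmetric] by (cases "z = 0") auto
  qed
  ultimately show ?thesis by (auto simp: orthogonal_comp_def orthogonal_def)
qed

(* For K = C, the real adjoint of a complex linear operator is its Hilbert space adjoint. *)
theorem theorem11:
  fixes s1 :: "'k::real_normed_field \<Rightarrow> 'a::{real_inner,banach} \<Rightarrow> 'a"
    and s2 :: "'k \<Rightarrow> 'b::{real_inner,banach} \<Rightarrow> 'b"
    and A11 :: "int \<Rightarrow> 'a \<Rightarrow>\<^sub>L 'a"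
    and A12 :: "int \<Rightarrow> 'b \<Rightarrow>\<^sub>L 'a"
    and A22 :: "int \<Rightarrow> 'b \<Rightarrow>\<^sub>L 'b"
  assumes "normed_scaling s1" and "normed_scaling s2"
    and "\<And>n. n \<le> 0 \<Longrightarrow> Vector_Spaces.linear s1 s1 (blinfun_apply (A11 n))"
    and "\<And>n. n \<le> 0 \<Longrightarrow> Vector_Spaces.linear s2 s1 (blinfun_apply (A12 n))"
    and "\<And>n. n \<le> 0 \<Longrightarrow> Vector_Spaces.linear s2 s2 (blinfun_apply (A22 n))"
    and "\<And>n. n \<le> 0 \<Longrightarrow> invertible_blinfun (A11 n)"
    and "\<And>n. n \<le> 0 \<Longrightarrow> invertible_blinfun (A22 n)"
    and "exp_dichotomy (module_prod.scale s1 s2) (\<lambda>n. block_upper (A11 n) (A12 n) (A22 n))"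
  shows "exp_dichotomy (module_prod.scale s1 s2) (\<lambda>n. block_upper (A11 n) 0 (A22 n)) \<longleftrightarrow>
     complemented s2 {v. bdd_above ((\<lambda>n. norm (full_transition A22 n 0 v)) ` {..0})} \<and>
     complemented s1 {v. bdd_above ((\<lambda>n. norm (adjoint (full_transition A11 0 n) v)) ` {..0})}"
proof -
  let ?diag = "exp_dichotomy (module_prod.scale s1 s2) (\<lambda>n. block_upper (A11 n) 0 (A22 n))"
  let ?U = "{v. bdd_above ((\<lambda>n. norm (full_transition A22 n 0 v)) ` {..0})}"
  let ?V = "{v. bdd_above ((\<lambda>n. norm (adjoint (full_transition A11 0 n) v)) ` {..0})}"
  note s = assms(1,2) and A = assms(6) and D = assms(7)
  have linA: "A11 n (s1 c x) = s1 c (A11 n x)" if "n \<le> 0" for n c x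
    using assms(3)[OF that] by (simp add: linear_blinfun_iff[OF s(1) s(1)])
  have linD: "A22 n (s2 c x) = s2 c (A22 n x)" if "n \<le> 0" for n c x
    using assms(5)[OF that] by (simp add: linear_blinfun_iff[OF s(2) s(2)])
  \<comment> \<open>Both spaces are rewritten with bounded operators: \<open>evolution\<close> for
    \<open>full_transition\<close>, \<open>adj\<close> for \<open>adjoint\<close>.\<close>
  have U: "?U = {v. bdd_above ((\<lambda>n. norm (evolution A22 n 0 v)) ` {..0})}"
    by (simp add: full_transition_evolution[of A22, OF D] cong: image_cong_simp)
  have V: "?V = {v. bdd_above ((\<lambda>n. norm (adj (evolution A11 0 n) v)) ` {..0})}"
    by (simp add: full_transition_evolution[of A11, OF A] adjoint_eq_adj cong: image_cong_simp)
  show ?thesis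
    unfolding U V
  proof (intro iffI conjI; (elim conjE)?)
    assume ?diag
    then obtain P K \<alpha> where K: "0 < K" "0 < \<alpha>"
      and data: "dichotomy_data (\<lambda>n. block_upper (A11 n) 0 (A22 n)) P K \<alpha>"
      and P: "\<And>n c x. n \<le> 0 \<Longrightarrow> P n (module_prod.scale s1 s2 c x) = module_prod.scale s1 s2 c (P n x)"
      by (rule exp_dichotomy_data) blast
    have P1: "P 0 (s1 c x, 0) = module_prod.scale s1 s2 c (P 0 (x, 0))"
      and P2: "P 0 (0, s2 c y) = module_prod.scale s1 s2 c (P 0 (0, y))" for c x y
      using P[of 0 c "(x, 0)"] P[of 0 c "(0, y)"]
      by (simp_all add: normed_scaling_prod(2)[OF s] normed_scaling_simps[OF s(1)] normed_scaling_simps[OF s(2)])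
    have zero: "module_prod.scale s1 s2 c 0 = 0" for c
      by (rule normed_scaling_simps(4)[OF normed_scaling_prod(1)[OF s]])
    have orbits2: "{v. bdd_above ((\<lambda>n. norm (evolution A22 n 0 v)) ` {..0})} = {v. P 0 (0, v) = 0}"
      using data K D by (rule bounded_orbits_22)
    have orbits1: "{v. bdd_above ((\<lambda>n. norm (adj (evolution A11 0 n) v)) ` {..0})} = {u. P 0 (u, 0) = 0}\<^sup>\<bottom>"
      using data K A by (rule bounded_adjoint_orbits_11)
    \<comment> \<open>The space is the preimage of 0 under a bounded operator, hence closed.\<close>
    show "complemented s2 {v. bdd_above ((\<lambda>n. norm (evolution A22 n 0 v)) ` {..0})}"
      unfolding orbits2
    proof (rule complemented_if_closed[OF s(2)])
      have "P 0 (0, x + y) = P 0 (0, x) + P 0 (0, y)" for x y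
        by (simp flip: blinfun.add_right)
      then show "module.subspace s2 {v. P 0 (0, v) = 0}"
        by (auto simp: subspace_normed_scaling_iff[OF s(2)] P2 zero blinfun.zero_right simp flip: zero_prod_def)
      show "closed {v. P 0 (0, v) = 0}"
        by (intro closed_Collect_eq continuous_intros)
    qed
    show "complemented s1 {v. bdd_above ((\<lambda>n. norm (adj (evolution A11 0 n) v)) ` {..0})}"
      unfolding orbits1
    proof (rule complemented_if_closed[OF s(1)])
      have "P 0 (x + y, 0) = P 0 (x, 0) + P 0 (y, 0)" for x y
        by (simp flip: blinfun.add_right)
      then have "module.subspace s1 {u. P 0 (u, 0) = 0}"
        by (auto simp: subspace_normed_scaling_iff[OF s(1)] P1 zero blinfun.zero_right simp flip: zero_prod_def)
      then show "module.subspace s1 ({u. P 0 (u, 0) = 0}\<^sup>\<bottom>)"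
        by (rule subspace_orthogonal_comp_scaling[OF s(1)])
      show "closed ({u. P 0 (u, 0) = 0}\<^sup>\<bottom>)" by (rule closed_orthogonal_comp)
    qed
  next
    assume compl2: "complemented s2 {v. bdd_above ((\<lambda>n. norm (evolution A22 n 0 v)) ` {..0})}"
      and compl1: "complemented s1 {v. bdd_above ((\<lambda>n. norm (adj (evolution A11 0 n) v)) ` {..0})}"
    obtain P K \<alpha> where K: "0 < K" "0 < \<alpha>"
      and data: "dichotomy_data (\<lambda>n. block_upper (A11 n) (A12 n) (A22 n)) P K \<alpha>"
      using assms(8) by (rule exp_dichotomy_data) blast
    have cocA: "cocycle (evolution A11)" using A by (rule cocycle_evolution)
    have cocD: "cocycle (evolution A22)" using D by (rule cocycle_evolution)
    have evA: "evolution A11 m n (s1 c x) = s1 c (evolution A11 m n x)" if "m \<le> 0" "n \<le> 0" for m n c x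
      using A linA that by (rule evolution_scaling)
    have evD: "evolution A22 m n (s2 c x) = s2 c (evolution A22 m n x)" if "m \<le> 0" "n \<le> 0" for m n c x
      using D linD that by (rule evolution_scaling)
    have green2: "green_bounds (evolution A22) (\<lambda>n. Blinfun (\<lambda>y. snd (P n (0, y)))) K \<alpha>"
      using data K(1) D by (rule green_bounds_22)
    have green1: "green_bounds (\<lambda>m n. adj (evolution A11 n m))
        (\<lambda>n. adj (id_blinfun - Blinfun (\<lambda>x. fst (P n (x, 0))))) K \<alpha>"
      using data K(1) A by (rule green_bounds_11_adj)
    obtain Q2 K2 where Q2: "0 < K2" "invariant_splitting s2 (evolution A22) Q2"
        "green_bounds (evolution A22) Q2 K2 \<alpha>"
      using s(2) cocD evD green2 K compl2 by (rule splitting_of_green_bounds) blast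
    \<comment> \<open>Adjoints reverse compositions and the exchanged indices restore the order. The
      bounded orbits of the transposed family from time 0 form exactly the space in
      \<open>compl1\<close>.\<close>
    have cocA': "cocycle (\<lambda>m n. adj (evolution A11 n m))"
      using cocA by (simp add: cocycle_def flip: adj_compose)
    have evA': "adj (evolution A11 n m) (s1 c x) = s1 c (adj (evolution A11 n m) x)"
      if "m \<le> 0" "n \<le> 0" for m n c x
      by (rule adj_scaling[OF s(1) s(1)]) (simp add: evA that)
    obtain Q1 K1 where Q1: "0 < K1" "invariant_splitting s1 (\<lambda>m n. adj (evolution A11 n m)) Q1"
        "green_bounds (\<lambda>m n. adj (evolution A11 n m)) Q1 K1 \<alpha>"
      using s(1) cocA' evA' green1 K compl1 by (rule splitting_of_green_bounds) blast
    \<comment> \<open>\<open>adj_splitting\<close> returns from the transposed family to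
      \<open>evolution A11\<close>; both blocks have kept the rate \<alpha> of the triangular
      system.\<close>
    show ?diag
      using s A D adj_splitting[OF s(1) Q1(2,3)] Q1(1) Q2(2,3,1) K(2) by (rule exp_dichotomy_block_diag)
  qed
qed

end
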